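(* Let $f_c\ge1$ be an integer, $n=2f_c+1$, $\sigma_0>0$, and let $\varepsilon=\varepsilon^{(1)}+\imath\varepsilon^{(2)}$ where $\varepsilon^{(1)},\varepsilon^{(2)}$ are i.i.d. real Gaussian vectors $\mathcal N_n(0,\sigma_0^2\mathrm{Id}_n)$, with coordinates indexed by $-f_c\le k\le f_c$. Then for all $0<u\le1$, $$\mathbb P\Big\{\frac{\|\mathcal F_n^*(\varepsilon)\|_\infty}{\sqrt n\,\|\varepsilon\|_2}>u\Big\}\le\Big(2\sqrt2+\frac{2n}{\sqrt3}\Big)\Big(1-\frac{u^2}{2}\Big)^n.$$ Furthermore, $\frac{\|\mathcal F_n^*(\varepsilon)\|_\infty}{\sqrt n\,\|\varepsilon\|_2}\le\sqrt2$ almost surely.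
   Context: For $c=(c_k)_{|k|\le f_c}\in\mathbb C^n$, $\mathcal F_n^*(c)$ is the trigonometric polynomial $\mathcal F_n^*(c)(t)=\sum_{k=-f_c}^{f_c}c_k\exp(2\pi\imath kt)$, $t\in[0,1]$, and $\|\cdot\|_\infty$ denotes the supremum of the modulus over $t\in[0,1]$. $\|\cdot\|_2$ is the Hermitian norm on $\mathbb C^n$. *)

theory Defs
  imports "HOL-Probability.Probability"
begin

definition freqs :: "nat \<Rightarrow> int set" where
  "freqs fc = {- int fc..int fc}"

text \<open>A vector of $n = 2 f_c + 1$ coordinates is a function on the index set \<open>freqs fc\<close>.\<close>

definition dual_fourier :: "nat \<Rightarrow> (int \<Rightarrow> complex) \<Rightarrow> real \<Rightarrow> complex" where
  "dual_fourier fc c t =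
     (\<Sum>k\<in>freqs fc. c k * exp (2 * complex_of_real pi * \<i> * of_int k * complex_of_real t))"

definition sup_norm :: "(real \<Rightarrow> complex) \<Rightarrow> real" where
  "sup_norm f = (SUP t\<in>{0..1}. cmod (f t))"

definition herm_norm :: "nat \<Rightarrow> (int \<Rightarrow> complex) \<Rightarrow> real" where
  "herm_norm fc c = L2_set (\<lambda>k. cmod (c k)) (freqs fc)"

text \<open>The centred Gaussian law on the real vectors indexed by \<open>I\<close>, with covariance matrix
  $\sigma^2 \mathrm{Id}$. The second parameter of \<^const>\<open>normal_density\<close> is the standard
  deviation.\<close>

definition isotropic_normal :: "'i set \<Rightarrow> real \<Rightarrow> ('i \<Rightarrow> real) measure" where
  "isotropic_normal I \<sigma> =
     (\<Pi>\<^sub>M k\<in>I. density lborel (\<lambda>x. ennreal (normal_density 0 \<sigma> x)))"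

end

theory Submission
  imports Defs
begin

text \<open>
  By the Cauchy--Schwarz inequality the ratio never exceeds 1, which settles the almost sure bound.

  For the tail bound, let $m = f_c$ and let $F$ be a trigonometric polynomial of degree $m$ whose
  modulus is maximal at $t_0$. Then $|F(t_0 + \delta) + F(t_0 - \delta)| \ge
  2 \cos(2\pi m\delta) |F(t_0)|$ for $0 \le 2\pi m\delta \le \pi/2$, because
  $F \mapsto F - \frac12 (F(\cdot + \delta) + F(\cdot - \delta))$ has norm at most
  $1 - \cos(2\pi m\delta)$ on such polynomials. So if the ratio exceeds $u$, then $|F|$ exceeds
  $\cos(\pi/12) \, u \sqrt n \, \|\varepsilon\|_2$ on a subset of $[-D, 1 + D]$ of measure at least
  $D = 1/(24 m)$, and by Fubini's theorem the probability of this is at most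
  $\frac{1 + 2D}{D} = 12 n - 10$ times the pointwise tail probability. At a fixed $t$ the rotation
  invariance of the Gaussian law gives
  $P\{|F(t)|^2 \ge w\, n \|\varepsilon\|_2^2\} = (1 - w)^{n-1}$. What remains is to compare
  $(12 n - 10)(1 - \frac{93}{100} u^2)^{n-1}$ with the claimed bound wherever the latter is below 1.
\<close>

section \<open>Comparison of the two tail bounds\<close>

text \<open>For small u the pointwise tail decays at about twice the exponential rate of the claimed
  bound. This slack pays for two losses: the factor cos(pi/12)^2 in the level and a much larger
  prefactor. With an angle theta in place of pi/12 one gets D = theta/(2 pi m) and the prefactor 2 +
  2 pi m/theta, so a smaller angle loses less in the level and more in the prefactor. The choice
  pi/12 gives 24 m + 2 = 12 n - 10 and cos(pi/12)^2 > 93/100, and with these values the comparison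
  succeeds for every n >= 3.

  The symmetric pair t0 + \<delta>, t0 - \<delta> suits a complex-valued F: no phase has to be
  controlled, and for each \<delta> one of the two points is large, which is what a measure estimate
  needs. The window [-D, 1 + D] is fixed in advance, so the random point t0 never has to be chosen
  measurably.

  The normalisation by the norm costs nothing at a fixed t: after a rotation F(t) is sqrt n times
  one complex coordinate, and the ratio compares this coordinate with the n - 1 others, which are
  independent of it. Hence an exact power.\<close>

text \<open>As functions of x = q/q0 the line and the parabola meet at x = 1, and the third
  hypothesis says that the line is at least as steep there. To the left of the meeting point it
  therefore runs below; the difference has the explicit factor 1 - x.\<close>

lemma affine_le_square:
  fixes a b q q0 :: real
  assumes "0 < q0" "q \<le> q0" "2 * (a * q0 - b) \<le> a * q0" "0 \<le> a" "0 \<le> b" "0 \<le> q"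
  shows "a * q - b \<le> (a * q0 - b) * (q / q0)\<^sup>2"
proof -
  define x where "x = q / q0"
  have q: "q = q0 * x" and x: "x \<le> 1" "0 \<le> x" using assms by (auto simp: x_def)
  have "(a * q0 - b) * x\<^sup>2 - (a * q - b) = (1 - x) * (a * q0 - (a * q0 - b) * (1 + x))"
    unfolding q by (simp add: algebra_simps power2_eq_square)
  moreover have "(a * q0 - b) * (1 + x) \<le> a * q0"
  proof (cases "a * q0 - b \<ge> 0")
    case True
    then have "(a * q0 - b) * (1 + x) \<le> (a * q0 - b) * 2" using x by (intro mult_left_mono) auto
    then show ?thesis using assms by linarith
  next
    case False
    then have "(a * q0 - b) * (1 + x) \<le> 0" using x by (intro mult_nonpos_nonneg) auto
    moreover have "0 \<le> a * q0" using assms by auto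
    ultimately show ?thesis by linarith
  qed
  ultimately have "(a * q0 - b) * x\<^sup>2 - (a * q - b) \<ge> 0" using x by simp
  then show ?thesis unfolding x_def by simp
qed

text \<open>For $q \ge q_0$ the right-hand side is at least 1; below $q_0$ the exponential rate of the
  left-hand side is the larger one, so it suffices to compare the two sides at $q_0$.\<close>

lemma tail_comparison_threshold:
  fixes C p q q0 :: real
  assumes n: "2 \<le> n" and p: "p \<le> 1" "p \<le> K * (186/100 * q - 86/100) ^ (n - 1)"
    and q: "1/2 \<le> q" and K: "0 \<le> K" and q0: "1/2 \<le> q0" "q0 \<le> 23/25"
    and C: "1 \<le> C * q0 ^ n" and chk: "K * (186/100 * q0 - 86/100) ^ (n - 1) \<le> 1"
  shows "p \<le> C * q ^ n"
proof -
  have C0: "0 < C"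
  proof (rule ccontr)
    assume "\<not> 0 < C"
    then have "C * q0 ^ n \<le> 0" using q0 by (intro mult_nonpos_nonneg) auto
    then show False using C by linarith
  qed
  show ?thesis
  proof (cases "q0 \<le> q")
    case True
    then have "C * q0 ^ n \<le> C * q ^ n"
      using C0 q0 by (intro mult_left_mono power_mono) auto
    then show ?thesis using C p by linarith
  next
    case False
    define x where "x = q / q0"
    have x: "0 \<le> x" "x \<le> 1" using False q q0 by (auto simp: x_def)
    \<comment> \<open>The slope condition reads q0 <= 172/186, which \<open>q0 \<le> 23/25\<close>
      ensures.\<close>
    have "186/100 * q - 86/100 \<le> (186/100 * q0 - 86/100) * x\<^sup>2"
      unfolding x_def using False q q0 by (intro affine_le_square) auto
    then have "(186/100 * q - 86/100) ^ (n - 1) \<le> ((186/100 * q0 - 86/100) * x\<^sup>2) ^ (n - 1)"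
      using q by (intro power_mono) auto
    also have "\<dots> = (186/100 * q0 - 86/100) ^ (n - 1) * x ^ (2 * (n - 1))"
      by (simp add: power_mult_distrib power_mult)
    \<comment> \<open>The square gives the exponent 2 * (n - 1), which is at least n because n >= 2;
      a smaller exponent only enlarges a power of x <= 1.\<close>
    also have "\<dots> \<le> (186/100 * q0 - 86/100) ^ (n - 1) * x ^ n"
      using n x q0 by (intro mult_left_mono power_decreasing zero_le_power) auto
    finally have "p \<le> K * ((186/100 * q0 - 86/100) ^ (n - 1) * x ^ n)"
      using p(2) K by (meson mult_left_mono order_trans)
    also have "\<dots> \<le> 1 * x ^ n"
      unfolding mult.assoc[symmetric] using chk x by (intro mult_right_mono) auto
    also have "\<dots> \<le> C * q0 ^ n * x ^ n" using C x by (intro mult_right_mono) auto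
    also have "\<dots> = C * q ^ n" using q0 by (simp add: x_def power_divide)
    finally show ?thesis .
  qed
qed

text \<open>By convexity q^(7/4) lies above its tangent 7/4 q - 3/4 at q = 1, and for q <= 1 the
  steeper line through the same point lies below that tangent. Writing q = s^4 makes the tangent
  inequality polynomial, with a double root at s = 1.\<close>

lemma affine_pow4_le_pow7:
  fixes q :: real
  assumes "1/2 \<le> q" "q \<le> 1"
  shows "(186/100 * q - 86/100) ^ 4 \<le> q ^ 7"
proof -
  define s where "s = root 4 q"
  have s: "0 \<le> s" "s ^ 4 = q" using assms by (auto simp: s_def)
  have "(s - 1)\<^sup>2 * (4 * s ^ 5 + 8 * s ^ 4 + 12 * s ^ 3 + 9 * s ^ 2 + 6 * s + 3) = 4 * s ^ 7 - 7 * s ^ 4 + 3"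
    by (simp add: algebra_simps power2_eq_square power_numeral_reduce)
  moreover have "0 \<le> (s - 1)\<^sup>2 * (4 * s ^ 5 + 8 * s ^ 4 + 12 * s ^ 3 + 9 * s ^ 2 + 6 * s + 3)"
    using s(1) by (intro mult_nonneg_nonneg add_nonneg_nonneg) auto
  ultimately have "7 * q - 3 \<le> 4 * s ^ 7" using s by simp
  then have "186/100 * q - 86/100 \<le> s ^ 7" using assms by linarith
  then have "(186/100 * q - 86/100) ^ 4 \<le> (s ^ 7) ^ 4"
    using assms by (intro power_mono) auto
  also have "\<dots> = q ^ 7" unfolding s(2)[symmetric] by (simp flip: power_mult)
  finally show ?thesis .
qed

text \<open>In the range where C q^n < 1, the previous lemma gives X <= Y^(5/3), hence K X <= (C
  Y)^(5/3) <= C Y as soon as K <= C^(5/3). The comparison for all q is thus reduced to a single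
  inequality between prefactors. Integer powers replace the fractional exponents throughout.\<close>

lemma tail_comparison_large:
  fixes C p q K :: real
  assumes n: "21 \<le> n" and p: "p \<le> 1" "p \<le> K * (186/100 * q - 86/100) ^ (n - 1)"
    and q: "1/2 \<le> q" "q \<le> 1" and K: "0 \<le> K" "K ^ 3 \<le> C ^ 5" and C: "0 < C"
  shows "p \<le> C * q ^ n"
proof (cases "1 \<le> C * q ^ n")
  case True
  then show ?thesis using p by linarith
next
  case False
  define X Y where "X = (186/100 * q - 86/100) ^ (n - 1)" and "Y = q ^ n"
  have X: "0 \<le> X" and Y: "0 \<le> Y" using q by (auto simp: X_def Y_def)
  have "(X ^ 3) ^ 4 = ((186/100 * q - 86/100) ^ 4) ^ (3 * (n - 1))"
    unfolding X_def by (simp add: mult_ac flip: power_mult)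
  also have "\<dots> \<le> (q ^ 7) ^ (3 * (n - 1))"
    using q by (intro power_mono affine_pow4_le_pow7) auto
  also have "\<dots> = q ^ (21 * (n - 1))" by (simp flip: power_mult)
  \<comment> \<open>Here 21 comes from: 21 * (n - 1) >= 20 * n holds exactly for n >= 21.\<close>
  also have "\<dots> \<le> q ^ (20 * n)" using n q by (intro power_decreasing) auto
  also have "\<dots> = (Y ^ 5) ^ 4" unfolding Y_def by (simp add: mult_ac flip: power_mult)
  finally have "X ^ 3 \<le> Y ^ 5"
    using Y by (metis power_le_imp_le_base numeral_eq_Suc zero_le_power)
  then have "K ^ 3 * X ^ 3 \<le> C ^ 5 * Y ^ 5" using K X C by (intro mult_mono) auto
  also have "\<dots> = (C * Y) ^ 5" by (simp add: power_mult_distrib)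
  \<comment> \<open>Lowering the exponent is allowed because C * Y < 1 in this case.\<close>
  also have "\<dots> \<le> (C * Y) ^ 3" using False Y C by (intro power_decreasing) (auto simp: Y_def)
  finally have "(K * X) ^ 3 \<le> (C * Y) ^ 3" by (simp add: power_mult_distrib)
  then have "K * X \<le> C * Y" using C Y by (metis power_le_imp_le_base numeral_eq_Suc mult_nonneg_nonneg less_imp_le)
  then show ?thesis using p(2) by (simp add: X_def Y_def)
qed

lemma tail_comparison:
  fixes p v :: real
  assumes n: "3 \<le> n" and v: "0 \<le> v" "v \<le> 1"
    and p: "p \<le> 1" "p \<le> (12 * real n - 10) * (1 - 93/100 * v) ^ (n - 1)"
  shows "p \<le> (2 * sqrt 2 + 2 * real n / sqrt 3) * (1 - v / 2) ^ n"
proof -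
  \<comment> \<open>In terms of q the target is a pure power and the given bound is a power of an
    affine function.\<close>
  define q where "q = 1 - v / 2"
  \<comment> \<open>A rational lower bound for the target's prefactor, from 1.414 <= sqrt 2 and
    0.577 <= 1 / sqrt 3, so that the numerical checks are exact arithmetic.\<close>
  define C where "C = 2828/1000 + 1154/1000 * real n"
  have q: "1/2 \<le> q" "q \<le> 1" using v by (auto simp: q_def)
  have e: "1 - 93/100 * v = 186/100 * q - 86/100" by (simp add: q_def field_simps)
  have p2: "p \<le> (12 * real n - 10) * (186/100 * q - 86/100) ^ (n - 1)"
    using p(2) unfolding e .
  have "p \<le> C * q ^ n"
  proof (cases "21 \<le> n")
    case True
    \<comment> \<open>x is the growth of C relative to its value at n = 21, with the rate rounded
      down. At n = 21 the prefactors are 242 and about 27.06, and 242^3 is just below 27.06^5.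
      Beyond that, 12 n - 10 grows by at most the factor 1 + 5/3 x and C by at least 1 + x.\<close>
    define x where "x = (real n - 21) * (426/10000)"
    have x: "0 \<le> x" "real n = 21 + x * (10000/426)" using True by (auto simp: x_def field_simps)
    have "(12 * real n - 10) ^ 3 \<le> (242 * (1 + 5/3 * x)) ^ 3"
      using x by (intro power_mono) auto
    also have "\<dots> = 242 ^ 3 * (1 + 5/3 * x) ^ 3" by (rule power_mult_distrib)
    also have "\<dots> \<le> (2706/100) ^ 5 * (1 + x) ^ 5"
    proof (rule mult_mono)
      \<comment> \<open>The slope 5/3 makes the linear terms cancel; all remaining coefficients are
        positive.\<close>
      have "(1 + x) ^ 5 - (1 + 5/3 * x) ^ 3 = 5/3 * x^2 + 145/27 * x^3 + 5 * x^4 + x^5"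
        by (simp add: field_simps power_numeral_reduce)
      moreover have "\<dots> \<ge> 0" using x by simp
      ultimately show "(1 + 5/3 * x) ^ 3 \<le> (1 + x) ^ 5" by simp
    qed (use x in \<open>auto simp: power_divide\<close>)
    also have "\<dots> = (2706/100 * (1 + x)) ^ 5" by (rule power_mult_distrib[symmetric])
    also have "\<dots> \<le> C ^ 5"
    proof (rule power_mono)
      show "2706/100 * (1 + x) \<le> C" unfolding C_def x(2) using x(1) by (simp add: field_simps)
    qed (use x in auto)
    finally have "(12 * real n - 10) ^ 3 \<le> C ^ 5" .
    then show ?thesis using True p q p2
      by (intro tail_comparison_large[of n p "12 * real n - 10"]) (auto simp: C_def)
  next
    case False
    \<comment> \<open>The thresholds are $C^{-1/n}$ rounded up to two decimals.\<close>
    note thr = tail_comparison_threshold[OF _ p(1) p2 q(1)]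
    have "n \<in> set [3..<21]"
      unfolding set_upt using n False by (intro iffD2[OF atLeastLessThan_iff] conjI) simp_all
    also have "[3..<21] = [3,4,5,6,7,8,9,10,11,12,13,14,15,16,17,18,19,20]" by simp
    finally have "n \<in> {3,4,5,6,7,8,9,10,11,12,13,14,15,16,17,18,19,20}" by (simp only: list.set)
    then show ?thesis
      apply (elim insertE emptyE)
      subgoal by (rule thr[of "11/20"]) (simp_all add: C_def power_divide)
      subgoal by (rule thr[of "61/100"]) (simp_all add: C_def power_divide)
      subgoal by (rule thr[of "33/50"]) (simp_all add: C_def power_divide)
      subgoal by (rule thr[of "69/100"]) (simp_all add: C_def power_divide)
      subgoal by (rule thr[of "18/25"]) (simp_all add: C_def power_divide)
      subgoal by (rule thr[of "37/50"]) (simp_all add: C_def power_divide)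
      subgoal by (rule thr[of "19/25"]) (simp_all add: C_def power_divide)
      subgoal by (rule thr[of "77/100"]) (simp_all add: C_def power_divide)
      subgoal by (rule thr[of "39/50"]) (simp_all add: C_def power_divide)
      subgoal by (rule thr[of "4/5"]) (simp_all add: C_def power_divide)
      subgoal by (rule thr[of "81/100"]) (simp_all add: C_def power_divide)
      subgoal by (rule thr[of "41/50"]) (simp_all add: C_def power_divide)
      subgoal by (rule thr[of "41/50"]) (simp_all add: C_def power_divide)
      subgoal by (rule thr[of "83/100"]) (simp_all add: C_def power_divide)
      subgoal by (rule thr[of "21/25"]) (simp_all add: C_def power_divide)
      subgoal by (rule thr[of "21/25"]) (simp_all add: C_def power_divide)
      subgoal by (rule thr[of "17/20"]) (simp_all add: C_def power_divide)
      subgoal by (rule thr[of "17/20"]) (simp_all add: C_def power_divide)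
      done
  qed
  also have "\<dots> \<le> (2 * sqrt 2 + 2 * real n / sqrt 3) * q ^ n"
  proof (intro mult_right_mono)
    have "1414/1000 \<le> sqrt 2" by (rule real_le_rsqrt) (simp add: power2_eq_square)
    moreover have "577/1000 \<le> 1 / sqrt 3"
    proof -
      have "sqrt 3 \<le> 1000/577" by (rule real_le_lsqrt) (simp_all add: power2_eq_square)
      then show ?thesis by (simp add: field_simps)
    qed
    then have "577/1000 * real n \<le> 1 / sqrt 3 * real n" by (intro mult_right_mono) auto
    moreover have "2 * real n / sqrt 3 = 2 * (1 / sqrt 3 * real n)" by simp
    ultimately show "C \<le> 2 * sqrt 2 + 2 * real n / sqrt 3" unfolding C_def by linarith
  qed (use q in auto)
  finally show ?thesis unfolding q_def .
qed

section \<open>Trigonometric polynomials near their maximum\<close>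

lemma sum_cis_multiples:
  fixes N :: nat and a :: int
  assumes "0 < N"
  shows "(\<Sum>j<N. cis (2 * pi * real j * real_of_int a / real N)) = (if int N dvd a then of_nat N else 0)"
proof -
  define z where "z = cis (2 * pi * real_of_int a / real N)"
  have pow: "cis (2 * pi * real j * real_of_int a / real N) = z ^ j" for j
    unfolding z_def by (simp only: Complex.DeMoivre) (simp add: mult_ac)
  have zN: "z ^ N = 1"
  proof -
    have "z ^ N = cis (2 * pi * real_of_int a)" unfolding z_def using assms by (simp only: Complex.DeMoivre) (simp add: mult_ac)
    then show ?thesis by simp
  qed
  have z1: "z = 1 \<longleftrightarrow> int N dvd a"
  proof
    assume "z = 1"
    then have "exp (\<i> * of_real (2 * pi * real_of_int a / real N)) = 1"
      by (simp add: z_def cis_conv_exp)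
    then obtain k :: int where "2 * pi * real_of_int a / real N = of_int (2 * k) * pi"
      by (auto simp: exp_eq_1)
    then have "real_of_int a = of_int k * real N" using assms by (simp add: field_simps)
    then have "a = k * int N" by (metis of_int_eq_iff of_int_mult of_int_of_nat_eq)
    then show "int N dvd a" by simp
  next
    assume "int N dvd a"
    then obtain k where "a = int N * k" by auto
    then show "z = 1" using assms cis_multiple_2pi[of "of_int k"] by (simp add: z_def mult.assoc)
  qed
  show ?thesis
  proof (cases "z = 1")
    case True
    then show ?thesis using z1 by (simp add: pow)
  next
    case False
    then have "(\<Sum>j<N. z ^ j) = 0" using zN by (simp add: geometric_sum)
    then show ?thesis using False z1 by (simp add: pow)
  qed
qed

text \<open>Summation by parts: $\psi = \pi j/m$ satisfies
  $(\cos\theta - \cos\psi) \, S = \sin(m\theta)\sin\theta$ for the sum $S$ in question.\<close>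

lemma dft_cos_nonneg:
  fixes m j :: nat and \<theta> :: real
  assumes \<theta>: "0 \<le> \<theta>" "real m * \<theta> \<le> pi / 2" and j: "j < 2 * m"
  shows "0 \<le> (\<Sum>k<2*m. (1 - cos ((real k - real m) * \<theta>)) * cos (2 * pi * real j * real k / real (2 * m)))"
proof (cases "j = 0")
  case True
  then show ?thesis by (auto intro!: sum_nonneg)
next
  case False
  define \<psi> where "\<psi> = pi * real j / real m"
  define p where "p x = 1 - cos ((x - real m) * \<theta>)" for x
  define c where "c x = cos (\<psi> * x)" for x
  define S where "S = (\<Sum>k<2*m. p (real k) * c (real k))"
  \<comment> \<open>The discrete Wronskian of p and c. Both 1 - p and c solve three-term
    recurrences, with factors 2 cos \<theta> and 2 cos \<psi>, so the increments of f are multiples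
    of p * c up to a term in c alone.\<close>
  define f where "f k = p (real k - 1) * c (real k) - c (real k - 1) * p (real k)" for k
  have m: "m > 0" using j by auto
  have step: "f (Suc k) - f k = 2 * (cos \<psi> - cos \<theta>) * (p (real k) * c (real k)) - 2 * (1 - cos \<theta>) * c (real k)" for k
  proof -
    define y where "y = (real k - real m) * \<theta>"
    have c: "c (real k + 1) + c (real k - 1) = 2 * cos \<psi> * c (real k)"
      unfolding c_def by (simp add: cos_add cos_diff distrib_left right_diff_distrib)
    have y: "(real k + 1 - real m) * \<theta> = y + \<theta>" "(real k - 1 - real m) * \<theta> = y - \<theta>"
      by (simp_all add: y_def algebra_simps)
    have p: "p (real k + 1) + p (real k - 1) = 2 - 2 * cos \<theta> * (1 - p (real k))"
      unfolding p_def y by (simp add: cos_add cos_diff y_def)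
    have "f (Suc k) - f k = p (real k) * (c (real k + 1) + c (real k - 1)) - c (real k) * (p (real k + 1) + p (real k - 1))"
      unfolding f_def by (simp add: algebra_simps)
    then show ?thesis unfolding c p by (simp add: algebra_simps)
  qed
  \<comment> \<open>The term in c alone sums to zero over a full period, since j is not a multiple
    of 2m.\<close>
  have c0: "(\<Sum>k<2*m. c (real k)) = 0"
  proof -
    have "(\<Sum>k<2*m. cis (2 * pi * real k * real_of_int (int j) / real (2 * m))) = 0"
      using sum_cis_multiples[of "2 * m" "int j"] m j False by (auto dest!: zdvd_imp_le)
    then have "(\<Sum>k<2*m. Re (cis (2 * pi * real k * real j / real (2 * m)))) = 0"
      unfolding Re_sum[symmetric] by simp
    then show ?thesis by (simp add: c_def \<psi>_def mult_ac)
  qed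
  have "f (2 * m) - f 0 = (\<Sum>k<2*m. f (Suc k) - f k)" by (simp add: sum_lessThan_telescope)
  also have "\<dots> = 2 * (cos \<psi> - cos \<theta>) * S - 2 * (1 - cos \<theta>) * (\<Sum>k<2*m. c (real k))"
    unfolding step S_def sum_subtractf sum_distrib_left by simp
  finally have t1: "f (2 * m) - f 0 = 2 * (cos \<psi> - cos \<theta>) * S" using c0 by simp
  have per: "\<psi> * (2 * real m) = 2 * pi * real j" using m by (simp add: \<psi>_def)
  have cN: "c (2 * real m) = 1" "c (2 * real m - 1) = cos \<psi>"
    unfolding c_def right_diff_distrib per using cos_int_2pin[of "int j"] sin_int_2pin[of "int j"]
    by (simp_all add: cos_diff)
  \<comment> \<open>At both ends c takes the values 1 and cos \<psi>, and p(2m) = p(0) by symmetry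
    about m, so only the difference of the two outer values of p survives.\<close>
  have "f (2 * m) - f 0 = p (2 * real m - 1) - p (- 1)"
    unfolding f_def using cN by (simp add: p_def) (simp add: c_def)
  also have "\<dots> = cos (real m * \<theta> + \<theta>) - cos (real m * \<theta> - \<theta>)"
  proof -
    have "(2 * real m - 1 - real m) * \<theta> = real m * \<theta> - \<theta>" "(- 1 - real m) * \<theta> = - (real m * \<theta> + \<theta>)"
      by (simp_all add: algebra_simps)
    then show ?thesis unfolding p_def by (simp only: cos_minus)
  qed
  also have "\<dots> = - 2 * (sin (real m * \<theta>) * sin \<theta>)" by (simp add: cos_add cos_diff)
  finally have S: "(cos \<theta> - cos \<psi>) * S = sin (real m * \<theta>) * sin \<theta>" using t1 by (simp add: algebra_simps)
  have \<theta>m: "\<theta> \<le> pi / 2 / real m" using \<theta> m by (simp add: field_simps)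
  have \<theta>2: "\<theta> \<le> pi / 2" using mult_right_mono[of 1 "real m" \<theta>] \<theta> m by simp
  have "0 \<le> sin (real m * \<theta>) * sin \<theta>"
    using \<theta> \<theta>2 by (intro mult_nonneg_nonneg sin_ge_zero) auto
  \<comment> \<open>For 0 < j < 2m the angle \<psi> keeps a distance of at least pi/m from the
    multiples of 2 pi, whereas \<theta> <= pi/(2m).\<close>
  moreover have "cos \<psi> < cos \<theta>"
  proof -
    have lt: "\<theta> < pi / real m" using \<theta>m m by (simp add: field_simps) (use pi_gt_zero in linarith)
    have ge: "pi / real m \<le> \<psi>" using False m by (simp add: \<psi>_def field_simps)
    have le: "\<psi> \<le> 2 * pi - pi / real m"
    proof -
      have "real j + 1 \<le> 2 * real m" using j by linarith
      then have "pi * (real j + 1) \<le> pi * (2 * real m)" by (intro mult_left_mono) auto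
      then show ?thesis using m by (simp add: \<psi>_def field_simps)
    qed
    show ?thesis
    proof (cases "\<psi> \<le> pi")
      case True
      then show ?thesis using lt ge \<theta> by (intro cos_monotone_0_pi) auto
    next
      case False
      have "cos (2 * pi - \<psi>) < cos \<theta>" using lt le False \<theta> by (intro cos_monotone_0_pi) auto
      then show ?thesis by (simp add: cos_diff)
    qed
  qed
  ultimately have "0 \<le> S" using S by (metis diff_gt_0_iff_gt zero_le_mult_iff not_le)
  then show ?thesis unfolding S_def p_def c_def \<psi>_def by (simp add: mult_ac)
qed

text \<open>Inverting a cosine transform returns the mean of p(k) and p(N - k), and these agree by
  symmetry. The endpoint k = N is included because the 2m + 1 frequencies become the indices 0, ...,
  2m, one more than the period N = 2m.\<close>

lemma dft_cos_inversion:
  fixes p :: "nat \<Rightarrow> real"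
  assumes N: "0 < N" and k: "k \<le> N" and sym: "\<And>k. k \<le> N \<Longrightarrow> p (N - k) = p k"
  shows "(\<Sum>j<N. complex_of_real ((\<Sum>l<N. p l * cos (2 * pi * real j * real l / real N)) / real N)
            * cis (2 * pi * real j * real k / real N)) = complex_of_real (p k)"
proof -
  define e where "e j a = cis (2 * pi * real j * real_of_int a / real N)" for j a
  have cis_split: "complex_of_real (cos (2 * pi * real j * real l / real N)) * cis (2 * pi * real j * real k / real N)
      = (e j (int k + int l) + e j (int k - int l)) / 2" for j l
  proof -
    define x y where "x = 2 * pi * real j * real l / real N" and "y = 2 * pi * real j * real k / real N"
    have "e j (int k + int l) = cis (y + x)" "e j (int k - int l) = cis (y - x)"
      by (simp_all add: e_def x_def y_def distrib_left right_diff_distrib add_divide_distrib diff_divide_distrib)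
    then show ?thesis unfolding x_def[symmetric] y_def[symmetric]
      by (simp add: complex_eq_iff cos_add cos_diff sin_add sin_diff)
  qed
  have eq: "(\<Sum>j<N. e j a) = (if int N dvd a then of_nat N else 0)" for a
    unfolding e_def by (rule sum_cis_multiples[OF N])
  \<comment> \<open>The reduction mod N covers both k = 0 and k = N, where the solution is l =
    0.\<close>
  have d1: "int N dvd int k + int l \<longleftrightarrow> l = (N - k) mod N" if "l < N" for l
  proof (cases "k = 0")
    case True
    then show ?thesis using that N by (auto dest: nat_dvd_not_less)
  next
    case False
    have "int N dvd int k + int l \<longleftrightarrow> N dvd k + l" by (metis of_nat_add of_nat_dvd_iff)
    also have "\<dots> \<longleftrightarrow> k + l = N"
    proof
      assume "N dvd k + l"
      then obtain r where r: "k + l = N * r" by auto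
      have "N * r < N * 2" using k that by (simp flip: r)
      moreover have "r \<noteq> 0" using r False by (intro notI) simp
      ultimately have "r = 1" by simp
      then show "k + l = N" using r by simp
    qed simp
    finally show ?thesis using False k that by auto
  qed
  have d2: "int N dvd int k - int l \<longleftrightarrow> l = k mod N" if "l < N" for l
    using that by (metis mod_eq_dvd_iff mod_less of_nat_eq_iff of_nat_mod)
  have pm: "p (k mod N) = p k" if "k \<le> N" for k
    using that sym[of 0] N by (cases "k = N") auto
  have "(\<Sum>j<N. complex_of_real ((\<Sum>l<N. p l * cos (2 * pi * real j * real l / real N)) / real N)
            * cis (2 * pi * real j * real k / real N))
     = (\<Sum>j<N. \<Sum>l<N. of_real (p l) / of_nat N * ((e j (int k + int l) + e j (int k - int l)) / 2))"
    unfolding cis_split[symmetric] by (simp add: sum_divide_distrib sum_distrib_left sum_distrib_right mult_ac)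
  also have "\<dots> = (\<Sum>l<N. of_real (p l) / of_nat N * (((\<Sum>j<N. e j (int k + int l)) + (\<Sum>j<N. e j (int k - int l))) / 2))"
    by (subst sum.swap) (simp add: sum.distrib sum_distrib_left sum_divide_distrib add_divide_distrib distrib_left)
  also have "\<dots> = (\<Sum>l<N. (if l = (N - k) mod N then of_real (p l) / 2 else 0) + (if l = k mod N then of_real (p l) / 2 else 0))"
    using N by (intro sum.cong) (auto simp: eq d1 d2 add_divide_distrib)
  also have "\<dots> = of_real (p ((N - k) mod N)) / 2 + of_real (p (k mod N)) / 2"
    using N by (simp add: sum.distrib)
  also have "\<dots> = of_real (p k)" using k by (simp add: pm sym)
  finally show ?thesis .
qed

section \<open>Trigonometric polynomials, their maxima and the multiplier bound\<close>

lemma finite_freqs [simp]: "finite (freqs m)"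
  by (simp add: freqs_def)

lemma card_freqs: "card (freqs m) = 2 * m + 1"
  by (simp add: freqs_def)

lemma dual_fourier_cis:
  "dual_fourier m c t = (\<Sum>k\<in>freqs m. c k * cis (2 * pi * real_of_int k * t))"
  unfolding dual_fourier_def by (intro sum.cong refl) (simp add: cis_conv_exp mult_ac)

lemma continuous_on_dual_fourier: "continuous_on A (dual_fourier m c)"
  unfolding dual_fourier_def by (intro continuous_intros)

lemma dual_fourier_frac: "dual_fourier m c (frac t) = dual_fourier m c t"
  unfolding dual_fourier_cis
proof (intro sum.cong refl)
  fix k
  have "2 * pi * real_of_int k * frac t = 2 * pi * real_of_int k * t - 2 * pi * of_int (k * \<lfloor>t\<rfloor>)"
    by (simp add: frac_def algebra_simps)
  then have "cis (2 * pi * real_of_int k * frac t) = cis (2 * pi * real_of_int k * t) / cis (2 * pi * of_int (k * \<lfloor>t\<rfloor>))"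
    by (simp only: cis_divide)
  then show "c k * cis (2 * pi * real_of_int k * frac t) = c k * cis (2 * pi * real_of_int k * t)"
    using cis_multiple_2pi[of "of_int (k * \<lfloor>t\<rfloor>)"] by simp
qed

text \<open>Periodicity carries the bound from [0, 1] to the whole line, where the translates used
  below lie.\<close>

lemma cmod_dual_fourier_le_sup_norm: "cmod (dual_fourier m c t) \<le> sup_norm (dual_fourier m c)"
proof -
  have "compact ((\<lambda>t. cmod (dual_fourier m c t)) ` {0..1})"
    by (intro compact_continuous_image continuous_intros continuous_on_dual_fourier) simp
  then have "cmod (dual_fourier m c (frac t)) \<le> sup_norm (dual_fourier m c)"
    unfolding sup_norm_def
    by (intro cSUP_upper) (auto simp: frac_lt_1 less_imp_le dest!: compact_imp_bounded bounded_imp_bdd_above)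
  then show ?thesis by (simp add: dual_fourier_frac)
qed

lemma sup_norm_dual_fourier_attained:
  obtains t where "t \<in> {0..1}" "cmod (dual_fourier m c t) = sup_norm (dual_fourier m c)"
proof -
  have "\<exists>t\<in>{0..1::real}. \<forall>s\<in>{0..1}. cmod (dual_fourier m c s) \<le> cmod (dual_fourier m c t)"
    by (intro continuous_attains_sup continuous_intros continuous_on_dual_fourier) auto
  then obtain t where t: "t \<in> {0..1}" "\<And>s. s \<in> {0..1} \<Longrightarrow> cmod (dual_fourier m c s) \<le> cmod (dual_fourier m c t)"
    by blast
  have "sup_norm (dual_fourier m c) \<le> cmod (dual_fourier m c t)"
    unfolding sup_norm_def using t by (intro cSUP_least) auto
  then show ?thesis using that t cmod_dual_fourier_le_sup_norm[of m c t] by (meson order_antisym)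
qed

text \<open>The multiplier $1 - \cos(k\theta)$, extended from $|k| \le m$ to a $2m$-periodic sequence,
  has alternating Fourier coefficients. Hence it acts as a discrete measure supported on the
  multiples of $1/(2m)$, whose total mass is the value of the multiplier at $k = m$.\<close>

lemma cosine_multiplier_bound:
  fixes m :: nat and B \<theta> :: real
  assumes m: "1 \<le> m" and \<theta>: "0 \<le> \<theta>" "real m * \<theta> \<le> pi / 2"
    and B: "\<And>t. cmod (dual_fourier m c t) \<le> B"
  shows "cmod (\<Sum>k\<in>freqs m. of_real (1 - cos (real_of_int k * \<theta>)) * (c k * cis (2 * pi * real_of_int k * t)))
    \<le> (1 - cos (real m * \<theta>)) * B"
proof -
  define N where "N = 2 * m"
  \<comment> \<open>Shifting the index by m multiplies the j-th coefficient by (-1)^j, which turns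
    alternating coefficients into nonnegative ones.\<close>
  define p where "p l = 1 - cos ((real l - real m) * \<theta>)" for l
  define \<beta> where "\<beta> j = (\<Sum>l<N. p l * cos (2 * pi * real j * real l / real N)) / real N" for j
  have N: "0 < N" using m by (simp add: N_def)
  have \<beta>0: "0 \<le> \<beta> j" if "j < N" for j
    unfolding \<beta>_def p_def using dft_cos_nonneg[OF \<theta>, of j] that by (simp add: N_def)
  have sym: "p (N - l) = p l" if "l \<le> N" for l
  proof -
    have "(real (N - l) - real m) * \<theta> = - ((real l - real m) * \<theta>)"
      using that by (simp add: N_def of_nat_diff algebra_simps)
    then show ?thesis unfolding p_def by (simp only: cos_minus)
  qed
  have inv: "(\<Sum>j<N. of_real (\<beta> j) * cis (2 * pi * real j * real l / real N)) = of_real (p l)" if "l \<le> N" for l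
    unfolding \<beta>_def by (intro dft_cos_inversion N that sym)
  \<comment> \<open>With N = 2m the factor \<open>cis (2 * pi * real j * real m / real N)\<close> is
    the sign (-1)^j undoing the shift l = k + m; what is left of the j-th exponential is a
    translation of t by j/N.\<close>
  have term_eq: "of_real (1 - cos (real_of_int k * \<theta>)) * (c k * cis (2 * pi * real_of_int k * t))
      = (\<Sum>j<N. of_real (\<beta> j) * cis (2 * pi * real j * real m / real N) *
                 (c k * cis (2 * pi * real_of_int k * (t + real j / real N))))" if "k \<in> freqs m" for k
  proof -
    define l where "l = nat (k + int m)"
    have l: "l \<le> N" "real l = real_of_int k + real m" using that by (auto simp: l_def freqs_def N_def)
    have "complex_of_real (1 - cos (real_of_int k * \<theta>)) = of_real (p l)" by (simp add: p_def l(2))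
    also have "\<dots> = (\<Sum>j<N. of_real (\<beta> j) * cis (2 * pi * real j * real l / real N))" by (rule inv[OF l(1), symmetric])
    finally have "of_real (1 - cos (real_of_int k * \<theta>)) * (c k * cis (2 * pi * real_of_int k * t))
      = (\<Sum>j<N. of_real (\<beta> j) * cis (2 * pi * real j * real l / real N) * (c k * cis (2 * pi * real_of_int k * t)))"
      by (simp add: sum_distrib_right)
    also have "\<dots> = (\<Sum>j<N. of_real (\<beta> j) * cis (2 * pi * real j * real m / real N) *
                 (c k * cis (2 * pi * real_of_int k * (t + real j / real N))))"
    proof (intro sum.cong refl)
      fix j
      have "2 * pi * real j * real l / real N + 2 * pi * real_of_int k * t
          = 2 * pi * real j * real m / real N + 2 * pi * real_of_int k * (t + real j / real N)"
        using N unfolding l(2) by (simp add: field_simps)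
      then have "cis (2 * pi * real j * real l / real N) * cis (2 * pi * real_of_int k * t)
          = cis (2 * pi * real j * real m / real N) * cis (2 * pi * real_of_int k * (t + real j / real N))"
        by (simp only: cis_mult)
      then show "of_real (\<beta> j) * cis (2 * pi * real j * real l / real N) * (c k * cis (2 * pi * real_of_int k * t))
        = of_real (\<beta> j) * cis (2 * pi * real j * real m / real N) *
                 (c k * cis (2 * pi * real_of_int k * (t + real j / real N)))"
        by (simp add: mult_ac)
    qed
    finally show ?thesis .
  qed
  have "(\<Sum>k\<in>freqs m. of_real (1 - cos (real_of_int k * \<theta>)) * (c k * cis (2 * pi * real_of_int k * t)))
      = (\<Sum>k\<in>freqs m. \<Sum>j<N. of_real (\<beta> j) * cis (2 * pi * real j * real m / real N) *
                 (c k * cis (2 * pi * real_of_int k * (t + real j / real N))))"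
    by (intro sum.cong refl term_eq)
  also have "\<dots> = (\<Sum>j<N. of_real (\<beta> j) * cis (2 * pi * real j * real m / real N) * dual_fourier m c (t + real j / real N))"
    unfolding dual_fourier_cis sum_distrib_left by (rule sum.swap)
  also have "cmod \<dots> \<le> (\<Sum>j<N. \<beta> j * B)"
    using \<beta>0 B by (intro sum_norm_le) (auto simp: norm_mult intro!: mult_left_mono)
  also have "\<dots> = (1 - cos (real m * \<theta>)) * B"
  proof -
    \<comment> \<open>Inversion at index 0, which stands for the frequency -m: all exponentials are
      1 there, so it yields the total mass.\<close>
    have "complex_of_real (\<Sum>j<N. \<beta> j) = of_real (p 0)" using inv[of 0] by simp
    then have "(\<Sum>j<N. \<beta> j) = p 0" by (simp only: of_real_eq_iff)
    then show ?thesis by (simp add: sum_distrib_right[symmetric] p_def)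
  qed
  finally show ?thesis .
qed

text \<open>The multiplier bound keeps the mean of the two values close to F(t), and the larger
  modulus is at least the mean of the moduli. The maximum is the useful form: for each \<delta> one
  of the two points is good.\<close>

lemma dual_fourier_near_maximum:
  fixes m :: nat and \<delta> :: real
  assumes m: "1 \<le> m" and \<delta>: "0 \<le> \<delta>" "2 * pi * real m * \<delta> \<le> pi / 2"
    and max: "cmod (dual_fourier m c t) = sup_norm (dual_fourier m c)"
  shows "cos (2 * pi * real m * \<delta>) * sup_norm (dual_fourier m c)
    \<le> max (cmod (dual_fourier m c (t + \<delta>))) (cmod (dual_fourier m c (t - \<delta>)))"
proof -
  define B where "B = sup_norm (dual_fourier m c)"
  define \<theta> where "\<theta> = 2 * pi * \<delta>"
  define R where "R = (\<Sum>k\<in>freqs m. of_real (1 - cos (real_of_int k * \<theta>)) * (c k * cis (2 * pi * real_of_int k * t)))"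
  have R: "cmod R \<le> (1 - cos (real m * \<theta>)) * B"
    unfolding R_def B_def using m \<delta>
    by (intro cosine_multiplier_bound cmod_dual_fourier_le_sup_norm) (auto simp: \<theta>_def mult_ac)
  have "cis (2 * pi * real_of_int k * (t + \<delta>)) + cis (2 * pi * real_of_int k * (t - \<delta>))
      = 2 * of_real (cos (real_of_int k * \<theta>)) * cis (2 * pi * real_of_int k * t)" for k
  proof -
    define x y where "x = 2 * pi * real_of_int k * t" and "y = real_of_int k * \<theta>"
    have "2 * pi * real_of_int k * (t + \<delta>) = x + y" "2 * pi * real_of_int k * (t - \<delta>) = x - y"
      by (simp_all add: x_def y_def \<theta>_def algebra_simps)
    then show ?thesis unfolding x_def[symmetric] y_def[symmetric]
      by (simp add: complex_eq_iff cos_add cos_diff sin_add sin_diff)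
  qed
  then have "dual_fourier m c (t + \<delta>) + dual_fourier m c (t - \<delta>) = 2 * dual_fourier m c t - 2 * R"
    unfolding dual_fourier_cis R_def sum.distrib[symmetric] distrib_left[symmetric] sum_distrib_left sum_subtractf[symmetric]
    by (intro sum.cong refl) (simp add: algebra_simps)
  then have "2 * dual_fourier m c t = dual_fourier m c (t + \<delta>) + dual_fourier m c (t - \<delta>) + 2 * R"
    by (simp only: diff_add_cancel)
  then have "cmod (2 * dual_fourier m c t) \<le> cmod (dual_fourier m c (t + \<delta>)) + cmod (dual_fourier m c (t - \<delta>)) + cmod (2 * R)"
    by (simp only:) (intro norm_triangle_le add_right_mono norm_triangle_ineq)
  then have "2 * B \<le> cmod (dual_fourier m c (t + \<delta>)) + cmod (dual_fourier m c (t - \<delta>)) + 2 * cmod R"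
    using max by (simp add: norm_mult B_def)
  then have "2 * (cos (real m * \<theta>) * B) \<le> cmod (dual_fourier m c (t + \<delta>)) + cmod (dual_fourier m c (t - \<delta>))"
    using R by (simp add: algebra_simps)
  moreover have "2 * pi * real m * \<delta> = real m * \<theta>" by (simp add: \<theta>_def)
  ultimately show ?thesis unfolding B_def[symmetric] by (simp only: le_max_iff_disj) linarith
qed

lemma cmod_dual_fourier_le: "cmod (dual_fourier m c t) \<le> sqrt (real (2 * m + 1)) * herm_norm m c"
proof -
  have "cmod (dual_fourier m c t) \<le> (\<Sum>k\<in>freqs m. \<bar>1\<bar> * \<bar>cmod (c k)\<bar>)"
    unfolding dual_fourier_cis by (rule order_trans[OF norm_sum]) (simp add: norm_mult)
  also have "\<dots> \<le> L2_set (\<lambda>_. 1) (freqs m) * L2_set (\<lambda>k. cmod (c k)) (freqs m)"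
    by (rule L2_set_mult_ineq)
  also have "L2_set (\<lambda>_. 1) (freqs m) = sqrt (real (2 * m + 1))"
    by (simp add: L2_set_def card_freqs)
  finally show ?thesis unfolding herm_norm_def .
qed

section \<open>Planar Gaussian integrals\<close>

abbreviation centred_normal :: "real \<Rightarrow> real measure" where
  "centred_normal \<sigma> \<equiv> density lborel (\<lambda>x. ennreal (normal_density 0 \<sigma> x))"

section \<open>Rotation invariance in the plane\<close>

lemma nn_integral_lborel_swap:
  assumes [measurable]: "f \<in> borel_measurable (borel \<Otimes>\<^sub>M borel)"
  shows "(\<integral>\<^sup>+x. \<integral>\<^sup>+y. f (x, y) \<partial>lborel \<partial>lborel) = (\<integral>\<^sup>+y. \<integral>\<^sup>+x. f (x::real, y::real) \<partial>lborel \<partial>lborel)"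
  by (rule lborel_pair.Fubini'[symmetric]) simp

text \<open>For c \<noteq> 0 the rotation is a composition of two affine substitutions in one
  variable each, with Jacobians |c| and 1/|c|, separated by an exchange of the integrals. For c = 0
  it exchanges the axes up to sign.\<close>

lemma nn_integral_lborel_rotation:
  fixes f :: "real \<times> real \<Rightarrow> ennreal" and c s :: real
  assumes f[measurable]: "f \<in> borel_measurable (borel \<Otimes>\<^sub>M borel)" and cs: "c\<^sup>2 + s\<^sup>2 = 1"
  shows "(\<integral>\<^sup>+x. \<integral>\<^sup>+y. f (c * x - s * y, s * x + c * y) \<partial>lborel \<partial>lborel) = (\<integral>\<^sup>+x. \<integral>\<^sup>+y. f (x, y) \<partial>lborel \<partial>lborel)"
    (is "?L = ?R")
proof (cases "c = 0")
  case True
  then have s: "s \<noteq> 0" "\<bar>s\<bar> = 1" using cs by (auto simp: abs_square_eq_1 power2_eq_1_iff)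
  have "?L = (\<integral>\<^sup>+x. \<integral>\<^sup>+y. f (- s * y, s * x) \<partial>lborel \<partial>lborel)" using True by simp
  also have "\<dots> = (\<integral>\<^sup>+x. \<integral>\<^sup>+y. f (y, s * x) \<partial>lborel \<partial>lborel)"
  proof (rule nn_integral_cong)
    fix x
    show "(\<integral>\<^sup>+y. f (- s * y, s * x) \<partial>lborel) = (\<integral>\<^sup>+y. f (y, s * x) \<partial>lborel)"
      using nn_integral_real_affine[of "\<lambda>y. f (y, s * x)" "- s" 0] s by simp
  qed
  also have "\<dots> = (\<integral>\<^sup>+y. \<integral>\<^sup>+x. f (y, s * x) \<partial>lborel \<partial>lborel)"
    by (rule nn_integral_lborel_swap[of "\<lambda>(x, y). f (y, s * x)", simplified]) measurable
  also have "\<dots> = ?R"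
  proof (rule nn_integral_cong)
    fix y
    show "(\<integral>\<^sup>+x. f (y, s * x) \<partial>lborel) = (\<integral>\<^sup>+x. f (y, x) \<partial>lborel)"
      using nn_integral_real_affine[of "\<lambda>x. f (y, x)" s 0] s by simp
  qed
  finally show ?thesis .
next
  case False
  have "?L = (\<integral>\<^sup>+y. \<integral>\<^sup>+x. f (c * x - s * y, s * x + c * y) \<partial>lborel \<partial>lborel)"
    by (rule nn_integral_lborel_swap[of "\<lambda>(x, y). f (c * x - s * y, s * x + c * y)", simplified]) measurable
  then have "ennreal \<bar>c\<bar> * ?L = (\<integral>\<^sup>+y. ennreal \<bar>c\<bar> * \<integral>\<^sup>+x. f (c * x - s * y, s * x + c * y) \<partial>lborel \<partial>lborel)"
    by (simp add: nn_integral_cmult)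
  also have "\<dots> = (\<integral>\<^sup>+y. \<integral>\<^sup>+x. f (x, s / c * x + 1 / c * y) \<partial>lborel \<partial>lborel)"
  proof (rule nn_integral_cong)
    fix y
    \<comment> \<open>This expresses the second coordinate through the first one and y; the
      coefficient of y collapses because 1 - s^2 = c^2.\<close>
    have "s / c * (- s * y + c * x) + 1 / c * y = s * x + c * y" for x
    proof -
      have "s / c * (- s * y + c * x) + 1 / c * y = s * x + (1 - s\<^sup>2) / c * y"
        using False by (simp add: field_simps power2_eq_square)
      also have "1 - s\<^sup>2 = c\<^sup>2" using cs by simp
      finally show ?thesis using False by (simp add: power2_eq_square)
    qed
    then show "ennreal \<bar>c\<bar> * (\<integral>\<^sup>+x. f (c * x - s * y, s * x + c * y) \<partial>lborel)
      = (\<integral>\<^sup>+x. f (x, s / c * x + 1 / c * y) \<partial>lborel)"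
      using nn_integral_real_affine[of "\<lambda>x. f (x, s / c * x + 1 / c * y)" c "- s * y"] False
      by (simp del: times_divide_eq_left)
  qed
  also have "\<dots> = (\<integral>\<^sup>+x. \<integral>\<^sup>+y. f (x, s / c * x + 1 / c * y) \<partial>lborel \<partial>lborel)"
    by (rule nn_integral_lborel_swap[of "\<lambda>(x, y). f (x, s / c * x + 1 / c * y)", unfolded prod.case, symmetric]) measurable
  also have "\<dots> = (\<integral>\<^sup>+x. ennreal \<bar>c\<bar> * \<integral>\<^sup>+y. f (x, y) \<partial>lborel \<partial>lborel)"
  proof (rule nn_integral_cong)
    fix x
    have "(\<integral>\<^sup>+y. f (x, y) \<partial>lborel) = ennreal \<bar>1 / c\<bar> * (\<integral>\<^sup>+y. f (x, s / c * x + 1 / c * y) \<partial>lborel)"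
      using False by (intro nn_integral_real_affine) auto
    moreover have "ennreal \<bar>c\<bar> * ennreal \<bar>1 / c\<bar> = 1"
      using False by (simp flip: ennreal_mult)
    ultimately show "(\<integral>\<^sup>+y. f (x, s / c * x + 1 / c * y) \<partial>lborel) = ennreal \<bar>c\<bar> * (\<integral>\<^sup>+y. f (x, y) \<partial>lborel)"
      by (simp add: mult.assoc[symmetric])
  qed
  also have "\<dots> = ennreal \<bar>c\<bar> * ?R" by (simp add: nn_integral_cmult)
  finally show ?thesis using False by (simp add: ennreal_mult_cancel_left)
qed

lemma normal_density_times:
  "normal_density 0 \<sigma> x * normal_density 0 \<sigma> y = 1 / (2 * pi * \<sigma>\<^sup>2) * exp (- (x\<^sup>2 + y\<^sup>2) / (2 * \<sigma>\<^sup>2))"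
  unfolding normal_density_def
  by (simp add: exp_add[symmetric] add_divide_distrib diff_divide_distrib flip: power2_eq_square)

lemma nn_integral_centred_normal_pair:
  assumes [measurable]: "f \<in> borel_measurable (borel \<Otimes>\<^sub>M borel)"
  shows "(\<integral>\<^sup>+x. \<integral>\<^sup>+y. f (x, y) \<partial>centred_normal \<sigma> \<partial>centred_normal \<sigma>)
    = (\<integral>\<^sup>+x. \<integral>\<^sup>+y. ennreal (normal_density 0 \<sigma> x * normal_density 0 \<sigma> y) * f (x, y) \<partial>lborel \<partial>lborel)"
  by (simp add: nn_integral_density nn_integral_cmult[symmetric] ennreal_mult mult.assoc)

lemma nn_integral_centred_normal_rotation:
  fixes f :: "real \<times> real \<Rightarrow> ennreal" and c s :: real
  assumes [measurable]: "f \<in> borel_measurable (borel \<Otimes>\<^sub>M borel)" and cs: "c\<^sup>2 + s\<^sup>2 = 1"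
  shows "(\<integral>\<^sup>+x. \<integral>\<^sup>+y. f (c * x - s * y, s * x + c * y) \<partial>centred_normal \<sigma> \<partial>centred_normal \<sigma>)
    = (\<integral>\<^sup>+x. \<integral>\<^sup>+y. f (x, y) \<partial>centred_normal \<sigma> \<partial>centred_normal \<sigma>)"
proof -
  define h where "h = (\<lambda>(x, y). ennreal (normal_density 0 \<sigma> x * normal_density 0 \<sigma> y) * f (x, y))"
  have [measurable]: "h \<in> borel_measurable (borel \<Otimes>\<^sub>M borel)" unfolding h_def by measurable
  have r: "(c * x - s * y)\<^sup>2 + (s * x + c * y)\<^sup>2 = x\<^sup>2 + y\<^sup>2" for x y
  proof -
    have "(c * x - s * y)\<^sup>2 + (s * x + c * y)\<^sup>2 = (c\<^sup>2 + s\<^sup>2) * (x\<^sup>2 + y\<^sup>2)"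
      by (simp add: algebra_simps power2_eq_square)
    then show ?thesis using cs by simp
  qed
  have "(\<integral>\<^sup>+x. \<integral>\<^sup>+y. f (c * x - s * y, s * x + c * y) \<partial>centred_normal \<sigma> \<partial>centred_normal \<sigma>)
     = (\<integral>\<^sup>+x. \<integral>\<^sup>+y. h (c * x - s * y, s * x + c * y) \<partial>lborel \<partial>lborel)"
    using nn_integral_centred_normal_pair[of "\<lambda>(x, y). f (c * x - s * y, s * x + c * y)" \<sigma>]
    unfolding h_def normal_density_times prod.case r by simp
  also have "\<dots> = (\<integral>\<^sup>+x. \<integral>\<^sup>+y. h (x, y) \<partial>lborel \<partial>lborel)"
    by (rule nn_integral_lborel_rotation[OF _ cs]) measurable
  also have "\<dots> = (\<integral>\<^sup>+x. \<integral>\<^sup>+y. f (x, y) \<partial>centred_normal \<sigma> \<partial>centred_normal \<sigma>)"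
    by (simp add: nn_integral_centred_normal_pair h_def)
  finally show ?thesis .
qed

lemma prob_space_centred_normal: "0 < \<sigma> \<Longrightarrow> prob_space (centred_normal \<sigma>)"
  using prob_space_normal_density[of \<sigma> 0] by simp

lemma nn_integral_centred_normal_swap:
  assumes \<sigma>: "0 < \<sigma>" and [measurable]: "f \<in> borel_measurable (borel \<Otimes>\<^sub>M borel)"
  shows "(\<integral>\<^sup>+x. \<integral>\<^sup>+y. f (x, y) \<partial>centred_normal \<sigma> \<partial>centred_normal \<sigma>)
    = (\<integral>\<^sup>+y. \<integral>\<^sup>+x. f (x, y) \<partial>centred_normal \<sigma> \<partial>centred_normal \<sigma>)"
proof -
  interpret prob_space "centred_normal \<sigma>" by (rule prob_space_centred_normal[OF \<sigma>])
  interpret pair_sigma_finite "centred_normal \<sigma>" "centred_normal \<sigma>" ..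
  show ?thesis by (rule Fubini'[symmetric]) simp
qed

section \<open>Explicit Gaussian integrals\<close>

text \<open>The factor |a|, a Jacobian in the application, gives the integrand an elementary
  antiderivative on each half-line.\<close>

lemma nn_integral_even_tail_gauss:
  fixes c \<tau> :: real
  assumes c: "0 < c" and \<tau>: "0 \<le> \<tau>"
  shows "(\<integral>\<^sup>+a. ennreal (\<bar>a\<bar> * exp (- c * a\<^sup>2)) * indicator {a. \<tau> \<le> a\<^sup>2} a \<partial>lborel) = ennreal (exp (- c * \<tau>) / c)"
proof -
  define g where "g a = ennreal (a * exp (- c * a\<^sup>2)) * indicator {sqrt \<tau>..} a" for a
  have [measurable]: "g \<in> borel_measurable borel" unfolding g_def by measurable
  have le: "\<tau> \<le> a\<^sup>2 \<longleftrightarrow> sqrt \<tau> \<le> \<bar>a\<bar>" for a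
    by (metis real_sqrt_abs real_sqrt_le_iff)
  have s0: "0 \<le> sqrt \<tau>" using \<tau> by simp
  \<comment> \<open>Without 0 the two half-lines are disjoint even when \<tau> = 0.\<close>
  have split: "AE a in lborel. ennreal (\<bar>a\<bar> * exp (- c * a\<^sup>2)) * indicator {a. \<tau> \<le> a\<^sup>2} a = g a + g (0 + (-1) * a)"
    using AE_lborel_singleton[of 0]
  proof eventually_elim
    case (elim a)
    consider "a > 0" "\<not> sqrt \<tau> \<le> - a" | "a < 0" "\<not> sqrt \<tau> \<le> a" using elim s0 by linarith
    then show ?case by cases (simp_all add: g_def le indicator_def)
  qed
  have "(\<integral>\<^sup>+a. g a \<partial>lborel) = ennreal (0 - - (exp (- c * (sqrt \<tau>)\<^sup>2) / (2 * c)))"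
    unfolding g_def
  proof (rule nn_integral_FTC_atLeast)
    fix x assume "sqrt \<tau> \<le> x"
    then show "0 \<le> x * exp (- c * x\<^sup>2)" using order_trans[OF s0] by (intro mult_nonneg_nonneg) simp_all
    show "((\<lambda>x. - (exp (- c * x\<^sup>2) / (2 * c))) has_real_derivative x * exp (- c * x\<^sup>2)) (at x)"
      using c by (auto intro!: derivative_eq_intros simp: field_simps)
  next
    show "((\<lambda>x. - (exp (- c * x\<^sup>2) / (2 * c))) \<longlongrightarrow> 0) at_top"
      using c by real_asymp
  qed simp
  then have g: "(\<integral>\<^sup>+a. g a \<partial>lborel) = ennreal (exp (- c * \<tau>) / (2 * c))" using \<tau> by simp
  have "(\<integral>\<^sup>+a. ennreal (\<bar>a\<bar> * exp (- c * a\<^sup>2)) * indicator {a. \<tau> \<le> a\<^sup>2} a \<partial>lborel) = (\<integral>\<^sup>+a. g a + g (0 + (-1) * a) \<partial>lborel)"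
    by (rule nn_integral_cong_AE[OF split])
  also have "\<dots> = (\<integral>\<^sup>+a. g a \<partial>lborel) + (\<integral>\<^sup>+a. g (0 + (-1) * a) \<partial>lborel)"
    by (rule nn_integral_add) auto
  also have "(\<integral>\<^sup>+a. g (0 + (-1) * a) \<partial>lborel) = (\<integral>\<^sup>+a. g a \<partial>lborel)"
    using nn_integral_real_affine[of g "-1" 0] by simp
  finally show ?thesis using c by (simp add: g ennreal_plus[symmetric] del: ennreal_plus)
qed

text \<open>Substituting $b = a s$ makes the $a$-integral explicit. The $s$-integral, a multiple of
  $\int ds/(1 + s^2)$, is then read off from the case $\tau = 0$.\<close>

lemma centred_normal_pair_tail:
  fixes \<sigma> \<tau> :: real
  assumes \<sigma>: "0 < \<sigma>" and \<tau>: "0 \<le> \<tau>"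
  shows "(\<integral>\<^sup>+a. \<integral>\<^sup>+b. indicator {\<tau>..} (a\<^sup>2 + b\<^sup>2) \<partial>centred_normal \<sigma> \<partial>centred_normal \<sigma>)
    = ennreal (exp (- \<tau> / (2 * \<sigma>\<^sup>2)))"
proof -
  define K where "K = 1 / (2 * pi * \<sigma>\<^sup>2)"
  define T where "T \<tau> = (\<integral>\<^sup>+a. \<integral>\<^sup>+b. indicator {\<tau>..} (a\<^sup>2 + b\<^sup>2) \<partial>centred_normal \<sigma> \<partial>centred_normal \<sigma>)" for \<tau>
  define h where "h \<tau> = (\<lambda>(a, b). ennreal (K * exp (- (a\<^sup>2 + b\<^sup>2) / (2 * \<sigma>\<^sup>2))) * indicator {\<tau>..} (a\<^sup>2 + b\<^sup>2))" for \<tau> :: real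
  have K: "0 < K" using \<sigma> by (simp add: K_def)
  have [measurable]: "h \<tau> \<in> borel_measurable (borel \<Otimes>\<^sub>M borel)" for \<tau> unfolding h_def by measurable
  \<comment> \<open>Since K * 2\<sigma>^2 = 1/pi, this is the standard Cauchy density, the law of
    the quotient b/a.\<close>
  define J where "J s = ennreal (K * (2 * \<sigma>\<^sup>2) / (1 + s\<^sup>2))" for s :: real
  have polar: "T \<tau> = ennreal (exp (- \<tau> / (2 * \<sigma>\<^sup>2))) * (\<integral>\<^sup>+s. J s \<partial>lborel)" if \<tau>: "0 \<le> \<tau>" for \<tau>
  proof -
    have "T \<tau> = (\<integral>\<^sup>+a. \<integral>\<^sup>+b. h \<tau> (a, b) \<partial>lborel \<partial>lborel)"
      unfolding T_def using nn_integral_centred_normal_pair[of "\<lambda>(a, b). indicator {\<tau>..} (a\<^sup>2 + b\<^sup>2)" \<sigma>]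
      by (simp add: h_def normal_density_times K_def)
    \<comment> \<open>The substitution b = a s degenerates only on the null set a = 0.\<close>
    also have "\<dots> = (\<integral>\<^sup>+a. \<integral>\<^sup>+s. ennreal \<bar>a\<bar> * h \<tau> (a, a * s) \<partial>lborel \<partial>lborel)"
    proof (rule nn_integral_cong_AE)
      show "AE a in lborel. (\<integral>\<^sup>+b. h \<tau> (a, b) \<partial>lborel) = (\<integral>\<^sup>+s. ennreal \<bar>a\<bar> * h \<tau> (a, a * s) \<partial>lborel)"
        using AE_lborel_singleton[of 0]
      proof eventually_elim
        case (elim a)
        then show ?case using nn_integral_real_affine[of "\<lambda>b. h \<tau> (a, b)" a 0]
          by (simp add: nn_integral_cmult)
      qed
    qed
    also have "\<dots> = (\<integral>\<^sup>+s. \<integral>\<^sup>+a. ennreal \<bar>a\<bar> * h \<tau> (a, a * s) \<partial>lborel \<partial>lborel)"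
      by (rule nn_integral_lborel_swap[of "\<lambda>(a, s). ennreal \<bar>a\<bar> * h \<tau> (a, a * s)", simplified]) measurable
    also have "\<dots> = (\<integral>\<^sup>+s. ennreal (exp (- \<tau> / (2 * \<sigma>\<^sup>2))) * J s \<partial>lborel)"
    proof (rule nn_integral_cong)
      fix s :: real
      \<comment> \<open>The factor 1 + s^2 multiplies the exponent and divides the threshold, so it
        cancels in the tail, and the dependence on \<tau> separates from that on s.\<close>
      define c where "c = (1 + s\<^sup>2) / (2 * \<sigma>\<^sup>2)"
      have s1: "0 < 1 + s\<^sup>2" by (simp add: add_pos_nonneg)
      have c: "0 < c" using \<sigma> s1 by (simp add: c_def)
      have e: "a\<^sup>2 + (a * s)\<^sup>2 = a\<^sup>2 * (1 + s\<^sup>2)" for a by (simp add: algebra_simps power_mult_distrib)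
      have "ennreal \<bar>a\<bar> * h \<tau> (a, a * s) = ennreal K * (ennreal (\<bar>a\<bar> * exp (- c * a\<^sup>2)) * indicator {a. \<tau> / (1 + s\<^sup>2) \<le> a\<^sup>2} a)" for a
      proof -
        have "- (a\<^sup>2 * (1 + s\<^sup>2)) / (2 * \<sigma>\<^sup>2) = - c * a\<^sup>2" by (simp add: c_def)
        moreover have "\<tau> \<le> a\<^sup>2 * (1 + s\<^sup>2) \<longleftrightarrow> \<tau> / (1 + s\<^sup>2) \<le> a\<^sup>2" using s1 by (simp add: pos_divide_le_eq)
        ultimately show ?thesis
          using K unfolding h_def prod.case e by (simp add: ennreal_mult mult_ac indicator_def)
      qed
      then have "(\<integral>\<^sup>+a. ennreal \<bar>a\<bar> * h \<tau> (a, a * s) \<partial>lborel)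
        = ennreal K * (\<integral>\<^sup>+a. (ennreal (\<bar>a\<bar> * exp (- c * a\<^sup>2)) * indicator {a. \<tau> / (1 + s\<^sup>2) \<le> a\<^sup>2} a) \<partial>lborel)"
        by (simp add: nn_integral_cmult)
      also have "\<dots> = ennreal K * ennreal (exp (- c * (\<tau> / (1 + s\<^sup>2))) / c)"
        using c \<tau> s1 by (subst nn_integral_even_tail_gauss) auto
      also have "- c * (\<tau> / (1 + s\<^sup>2)) = - \<tau> / (2 * \<sigma>\<^sup>2)" using s1 by (simp add: c_def)
      also have "ennreal K * ennreal (exp (- \<tau> / (2 * \<sigma>\<^sup>2)) / c) = ennreal (exp (- \<tau> / (2 * \<sigma>\<^sup>2))) * J s"
        unfolding J_def c_def using K s1 \<sigma> by (simp flip: ennreal_mult add: mult_ac)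
      finally show "(\<integral>\<^sup>+a. ennreal \<bar>a\<bar> * h \<tau> (a, a * s) \<partial>lborel) = ennreal (exp (- \<tau> / (2 * \<sigma>\<^sup>2))) * J s" .
    qed
    also have "\<dots> = ennreal (exp (- \<tau> / (2 * \<sigma>\<^sup>2))) * (\<integral>\<^sup>+s. J s \<partial>lborel)"
      unfolding J_def by (rule nn_integral_cmult) measurable
    finally show ?thesis .
  qed
  interpret prob_space "centred_normal \<sigma>" by (rule prob_space_centred_normal[OF \<sigma>])
  have "T 0 = 1"
    unfolding T_def using emeasure_space_1 by simp
  then have "(\<integral>\<^sup>+s. J s \<partial>lborel) = 1" using polar[of 0] by simp
  then show ?thesis using polar[OF \<tau>] by (simp add: T_def)
qed

text \<open>The exponential factor turns the density into a multiple of the normal density with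
  variance divided by 1 + c, which has total mass 1.\<close>

lemma nn_integral_centred_normal_exp_square:
  assumes \<sigma>: "0 < \<sigma>" and c: "0 \<le> c"
  shows "(\<integral>\<^sup>+x. ennreal (exp (- c * x\<^sup>2 / (2 * \<sigma>\<^sup>2))) \<partial>centred_normal \<sigma>) = ennreal (1 / sqrt (1 + c))"
proof -
  define \<sigma>' where "\<sigma>' = \<sigma> / sqrt (1 + c)"
  have \<sigma>': "0 < \<sigma>'" using \<sigma> c by (simp add: \<sigma>'_def)
  have sq: "\<sigma>'\<^sup>2 = \<sigma>\<^sup>2 / (1 + c)" using c by (simp add: \<sigma>'_def power_divide)
  have d: "normal_density 0 \<sigma> x * exp (- c * x\<^sup>2 / (2 * \<sigma>\<^sup>2)) = 1 / sqrt (1 + c) * normal_density 0 \<sigma>' x" for x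
  proof -
    have "exp (- x\<^sup>2 / (2 * \<sigma>\<^sup>2)) * exp (- c * x\<^sup>2 / (2 * \<sigma>\<^sup>2)) = exp (- x\<^sup>2 / (2 * \<sigma>'\<^sup>2))"
      unfolding exp_add[symmetric] sq using \<sigma> c by (simp add: field_simps)
    moreover have "1 / sqrt (2 * pi * \<sigma>\<^sup>2) = 1 / sqrt (1 + c) * (1 / sqrt (2 * pi * \<sigma>'\<^sup>2))"
      unfolding sq using \<sigma> c by (simp add: real_sqrt_divide real_sqrt_mult)
    ultimately show ?thesis unfolding normal_density_def by simp
  qed
  interpret prob_space "centred_normal \<sigma>'" by (rule prob_space_centred_normal[OF \<sigma>'])
  have "(\<integral>\<^sup>+x. ennreal (exp (- c * x\<^sup>2 / (2 * \<sigma>\<^sup>2))) \<partial>centred_normal \<sigma>)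
      = (\<integral>\<^sup>+x. ennreal (1 / sqrt (1 + c)) * ennreal (normal_density 0 \<sigma>' x) \<partial>lborel)"
    using c by (simp add: nn_integral_density d[simplified] flip: ennreal_mult)
  also have "\<dots> = ennreal (1 / sqrt (1 + c)) * (\<integral>\<^sup>+x. ennreal (normal_density 0 \<sigma>' x) \<partial>lborel)"
    by (rule nn_integral_cmult) measurable
  also have "(\<integral>\<^sup>+x. ennreal (normal_density 0 \<sigma>' x) \<partial>lborel) = 1"
    using emeasure_space_1 by (simp add: emeasure_density)
  finally show ?thesis by simp
qed

section \<open>Gaussian vectors\<close>

lemma sets_isotropic_normal [measurable_cong]: "sets (isotropic_normal I \<sigma>) = sets (\<Pi>\<^sub>M k\<in>I. borel)"
  unfolding isotropic_normal_def by (intro sets_PiM_cong) auto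

lemma nn_integral_isotropic_normal_empty:
  "(\<integral>\<^sup>+x. f x \<partial>isotropic_normal {} \<sigma>) = f (\<lambda>_. undefined)"
  unfolding isotropic_normal_def by (simp add: PiM_empty nn_integral_count_space_finite)

lemma nn_integral_isotropic_normal_insert:
  assumes "0 < \<sigma>" "finite I" "i \<notin> I" "f \<in> borel_measurable (\<Pi>\<^sub>M k\<in>insert i I. borel)"
  shows "(\<integral>\<^sup>+x. f x \<partial>isotropic_normal (insert i I) \<sigma>)
    = (\<integral>\<^sup>+a. \<integral>\<^sup>+x. f (x(i := a)) \<partial>isotropic_normal I \<sigma> \<partial>centred_normal \<sigma>)"
proof -
  interpret prob_space "centred_normal \<sigma>" by (rule prob_space_centred_normal[OF assms(1)])
  interpret product_sigma_finite "\<lambda>_. centred_normal \<sigma>" ..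
  have "f \<in> borel_measurable (\<Pi>\<^sub>M k\<in>insert i I. centred_normal \<sigma>)"
    using assms(4) by (subst measurable_cong_sets[OF sets_PiM_cong refl]) auto
  then show ?thesis
    unfolding isotropic_normal_def using assms by (intro product_nn_integral_insert_rev) auto
qed

lemma sigma_finite_isotropic_normal:
  assumes "0 < \<sigma>" "finite I"
  shows "sigma_finite_measure (isotropic_normal I \<sigma>)"
proof -
  interpret prob_space "centred_normal \<sigma>" by (rule prob_space_centred_normal[OF assms(1)])
  interpret product_sigma_finite "\<lambda>_. centred_normal \<sigma>" ..
  show ?thesis unfolding isotropic_normal_def by (rule sigma_finite[OF assms(2)])
qed

text \<open>An orthogonal map taking (1, ..., 1)/sqrt n to a coordinate axis preserves the law and
  the sum of squares. It is assembled from planar rotations, one per induction step, each merging a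
  new coordinate with the normalised sum so far. The test function g is arbitrary so that the new
  coordinate can be absorbed into it.\<close>

lemma nn_integral_isotropic_normal_sum:
  fixes g :: "real \<times> real \<Rightarrow> ennreal"
  assumes \<sigma>: "0 < \<sigma>" and "finite I" "i \<notin> I" and g: "g \<in> borel_measurable (borel \<Otimes>\<^sub>M borel)"
  shows "(\<integral>\<^sup>+x. g (\<Sum>k\<in>insert i I. x k, \<Sum>k\<in>insert i I. (x k)\<^sup>2) \<partial>isotropic_normal (insert i I) \<sigma>)
    = (\<integral>\<^sup>+a. \<integral>\<^sup>+x. g (sqrt (real (card I + 1)) * a, a\<^sup>2 + (\<Sum>k\<in>I. (x k)\<^sup>2)) \<partial>isotropic_normal I \<sigma> \<partial>centred_normal \<sigma>)"
  using assms(2-)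
proof (induction I arbitrary: g rule: finite_induct)
  case empty
  note [measurable] = empty(2)
  show ?case
    by (subst nn_integral_isotropic_normal_insert[OF \<sigma>]) (simp_all add: nn_integral_isotropic_normal_empty)
next
  case (insert k I g)
  note [measurable] = insert.prems(2)
  have kI: "finite I" "k \<notin> I" "i \<noteq> k" "i \<notin> I" using insert by auto
  interpret P: sigma_finite_measure "isotropic_normal I \<sigma>" by (rule sigma_finite_isotropic_normal[OF \<sigma> kI(1)])
  define n where "n = card I + 1"
  \<comment> \<open>Integrating out the untouched coordinates leaves a statement about the plane of
    b and a.\<close>
  define G where "G = (\<lambda>(z, r). \<integral>\<^sup>+x. g (z, r + (\<Sum>k\<in>I. (x k)\<^sup>2)) \<partial>isotropic_normal I \<sigma>)"
  have G[measurable]: "G \<in> borel_measurable (borel \<Otimes>\<^sub>M borel)" unfolding G_def by measurable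
  define s where "s = sqrt (real n + 1)"
  have s: "0 < s" "s\<^sup>2 = real n + 1" by (auto simp: s_def)
  have upd: "(\<Sum>j\<in>I. f ((x(k := b)) j)) = (\<Sum>j\<in>I. f (x j))" for f :: "real \<Rightarrow> real" and x b
    using kI by (intro sum.cong) auto
  have "(\<integral>\<^sup>+x. g (\<Sum>j\<in>insert i (insert k I). x j, \<Sum>j\<in>insert i (insert k I). (x j)\<^sup>2) \<partial>isotropic_normal (insert i (insert k I)) \<sigma>)
     = (\<integral>\<^sup>+x. g (\<Sum>j\<in>insert k (insert i I). x j, \<Sum>j\<in>insert k (insert i I). (x j)\<^sup>2) \<partial>isotropic_normal (insert k (insert i I)) \<sigma>)"
    by (simp only: insert_commute)
  also have "\<dots> = (\<integral>\<^sup>+b. \<integral>\<^sup>+x. g (b + (\<Sum>j\<in>insert i I. x j), b\<^sup>2 + (\<Sum>j\<in>insert i I. (x j)\<^sup>2)) \<partial>isotropic_normal (insert i I) \<sigma> \<partial>centred_normal \<sigma>)"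
  proof (subst nn_integral_isotropic_normal_insert[OF \<sigma>])
    have "(\<Sum>j\<in>insert k (insert i I). f ((x(k := b)) j)) = f b + (\<Sum>j\<in>insert i I. f (x j))"
      for f :: "real \<Rightarrow> real" and x b
      using kI upd[of f x b] by simp
    from this[of "\<lambda>x. x"] this[of "\<lambda>x. x\<^sup>2"]
    show "(\<integral>\<^sup>+b. \<integral>\<^sup>+x. g (\<Sum>j\<in>insert k (insert i I). (x(k := b)) j, \<Sum>j\<in>insert k (insert i I). ((x(k := b)) j)\<^sup>2) \<partial>isotropic_normal (insert i I) \<sigma> \<partial>centred_normal \<sigma>)
      = (\<integral>\<^sup>+b. \<integral>\<^sup>+x. g (b + (\<Sum>j\<in>insert i I. x j), b\<^sup>2 + (\<Sum>j\<in>insert i I. (x j)\<^sup>2)) \<partial>isotropic_normal (insert i I) \<sigma> \<partial>centred_normal \<sigma>)"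
      by simp
  qed (use kI in auto)
  also have "\<dots> = (\<integral>\<^sup>+b. \<integral>\<^sup>+a. G (b + sqrt (real n) * a, b\<^sup>2 + a\<^sup>2) \<partial>centred_normal \<sigma> \<partial>centred_normal \<sigma>)"
  proof (rule nn_integral_cong)
    fix b
    have m: "(\<lambda>(z, r). g (b + z, b\<^sup>2 + r)) \<in> borel_measurable (borel \<Otimes>\<^sub>M borel)" by measurable
    show "(\<integral>\<^sup>+x. g (b + (\<Sum>j\<in>insert i I. x j), b\<^sup>2 + (\<Sum>j\<in>insert i I. (x j)\<^sup>2)) \<partial>isotropic_normal (insert i I) \<sigma>)
      = (\<integral>\<^sup>+a. G (b + sqrt (real n) * a, b\<^sup>2 + a\<^sup>2) \<partial>centred_normal \<sigma>)"
      using insert.IH[OF kI(4) m] unfolding prod.case by (simp add: G_def n_def add.assoc)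
  qed
  also have "\<dots> = (\<integral>\<^sup>+b. \<integral>\<^sup>+a. G (s * a, b\<^sup>2 + a\<^sup>2) \<partial>centred_normal \<sigma> \<partial>centred_normal \<sigma>)"
  proof -
    \<comment> \<open>(d, c) is the unit vector along (1, sqrt n), so after the rotation b + sqrt n
      * a is sqrt (n + 1) times a single coordinate.\<close>
    define c d where "c = sqrt (real n) / s" and "d = 1 / s"
    have cd: "c\<^sup>2 + d\<^sup>2 = 1"
      using s by (simp add: c_def d_def power_divide add_divide_distrib[symmetric])
    have 1: "s * (d * b + c * a) = b + sqrt (real n) * a" for a b
      using s by (simp add: c_def d_def field_simps)
    have 2: "(c * b - d * a)\<^sup>2 + (d * b + c * a)\<^sup>2 = b\<^sup>2 + a\<^sup>2" for a b
    proof -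
      have "(c * b - d * a)\<^sup>2 + (d * b + c * a)\<^sup>2 = (c\<^sup>2 + d\<^sup>2) * (b\<^sup>2 + a\<^sup>2)"
        by (simp add: algebra_simps power2_eq_square)
      then show ?thesis using cd by simp
    qed
    have m: "(\<lambda>(b, a). G (s * a, b\<^sup>2 + a\<^sup>2)) \<in> borel_measurable (borel \<Otimes>\<^sub>M borel)" by measurable
    show ?thesis using nn_integral_centred_normal_rotation[OF m cd, of \<sigma>] by (simp add: 1 2)
  qed
  also have "\<dots> = (\<integral>\<^sup>+a. \<integral>\<^sup>+b. G (s * a, b\<^sup>2 + a\<^sup>2) \<partial>centred_normal \<sigma> \<partial>centred_normal \<sigma>)"
    using nn_integral_centred_normal_swap[OF \<sigma>, of "\<lambda>(b, a). G (s * a, b\<^sup>2 + a\<^sup>2)"] by simp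
  \<comment> \<open>The rotated b takes the place of coordinate k among those that enter only
    through their squares.\<close>
  also have "\<dots> = (\<integral>\<^sup>+a. \<integral>\<^sup>+x. g (sqrt (real (card (insert k I) + 1)) * a, a\<^sup>2 + (\<Sum>j\<in>insert k I. (x j)\<^sup>2)) \<partial>isotropic_normal (insert k I) \<sigma> \<partial>centred_normal \<sigma>)"
  proof (rule nn_integral_cong)
    fix a
    have "(\<Sum>j\<in>insert k I. ((x(k := b)) j)\<^sup>2) = b\<^sup>2 + (\<Sum>j\<in>I. (x j)\<^sup>2)" for x :: "_ \<Rightarrow> real" and b
      using kI upd[of "\<lambda>x. x\<^sup>2" x b] by simp
    moreover have "sqrt (real (card (insert k I) + 1)) = s" using kI by (simp add: s_def n_def)
    ultimately show "(\<integral>\<^sup>+b. G (s * a, b\<^sup>2 + a\<^sup>2) \<partial>centred_normal \<sigma>)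
      = (\<integral>\<^sup>+x. g (sqrt (real (card (insert k I) + 1)) * a, a\<^sup>2 + (\<Sum>j\<in>insert k I. (x j)\<^sup>2)) \<partial>isotropic_normal (insert k I) \<sigma>)"
      using kI by (subst nn_integral_isotropic_normal_insert[OF \<sigma>]) (simp_all add: G_def add_ac)
  qed
  finally show ?case .
qed

lemma nn_integral_isotropic_normal_swap:
  assumes "0 < \<sigma>" "finite I" "finite J"
    and [measurable]: "f \<in> borel_measurable ((\<Pi>\<^sub>M k\<in>I. borel) \<Otimes>\<^sub>M (\<Pi>\<^sub>M k\<in>J. borel))"
  shows "(\<integral>\<^sup>+x. \<integral>\<^sup>+y. f (x, y) \<partial>isotropic_normal J \<sigma> \<partial>isotropic_normal I \<sigma>)
    = (\<integral>\<^sup>+y. \<integral>\<^sup>+x. f (x, y) \<partial>isotropic_normal I \<sigma> \<partial>isotropic_normal J \<sigma>)"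
proof -
  interpret P: sigma_finite_measure "isotropic_normal I \<sigma>" by (rule sigma_finite_isotropic_normal[OF assms(1,2)])
  interpret Q: sigma_finite_measure "isotropic_normal J \<sigma>" by (rule sigma_finite_isotropic_normal[OF assms(1,3)])
  interpret pair_sigma_finite "isotropic_normal I \<sigma>" "isotropic_normal J \<sigma>" ..
  show ?thesis by (rule Fubini'[symmetric]) measurable
qed

lemma nn_integral_isotropic_centred_normal_swap:
  assumes "0 < \<sigma>" "finite I" and [measurable]: "f \<in> borel_measurable ((\<Pi>\<^sub>M k\<in>I. borel) \<Otimes>\<^sub>M borel)"
  shows "(\<integral>\<^sup>+x. \<integral>\<^sup>+b. f (x, b) \<partial>centred_normal \<sigma> \<partial>isotropic_normal I \<sigma>)
    = (\<integral>\<^sup>+b. \<integral>\<^sup>+x. f (x, b) \<partial>isotropic_normal I \<sigma> \<partial>centred_normal \<sigma>)"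
proof -
  interpret P: sigma_finite_measure "isotropic_normal I \<sigma>" by (rule sigma_finite_isotropic_normal[OF assms(1,2)])
  interpret prob_space "centred_normal \<sigma>" by (rule prob_space_centred_normal[OF assms(1)])
  interpret pair_sigma_finite "isotropic_normal I \<sigma>" "centred_normal \<sigma>" ..
  show ?thesis by (rule Fubini'[symmetric]) measurable
qed

lemma nn_integral_isotropic_normal_exp_square:
  assumes \<sigma>: "0 < \<sigma>" and "finite I" and c: "0 \<le> c"
  shows "(\<integral>\<^sup>+x. ennreal (exp (- c * (\<Sum>k\<in>I. (x k)\<^sup>2) / (2 * \<sigma>\<^sup>2))) \<partial>isotropic_normal I \<sigma>)
    = ennreal ((1 / sqrt (1 + c)) ^ card I)"
proof -
  interpret prob_space "centred_normal \<sigma>" by (rule prob_space_centred_normal[OF \<sigma>])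
  interpret product_sigma_finite "\<lambda>_. centred_normal \<sigma>" ..
  have "exp (- c * (\<Sum>k\<in>I. (x k)\<^sup>2) / (2 * \<sigma>\<^sup>2)) = (\<Prod>k\<in>I. exp (- c * (x k)\<^sup>2 / (2 * \<sigma>\<^sup>2)))" for x :: "_ \<Rightarrow> real"
    using assms(2) by (simp add: exp_sum[symmetric] sum_distrib_left sum_divide_distrib sum_negf)
  then have "(\<integral>\<^sup>+x. ennreal (exp (- c * (\<Sum>k\<in>I. (x k)\<^sup>2) / (2 * \<sigma>\<^sup>2))) \<partial>isotropic_normal I \<sigma>)
     = (\<integral>\<^sup>+x. (\<Prod>k\<in>I. ennreal (exp (- c * (x k)\<^sup>2 / (2 * \<sigma>\<^sup>2)))) \<partial>isotropic_normal I \<sigma>)"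
    by (simp add: prod_ennreal)
  also have "\<dots> = (\<Prod>k\<in>I. \<integral>\<^sup>+x. ennreal (exp (- c * x\<^sup>2 / (2 * \<sigma>\<^sup>2))) \<partial>centred_normal \<sigma>)"
    unfolding isotropic_normal_def using assms(2)
    by (intro product_nn_integral_prod[where f = "\<lambda>_ x. ennreal (exp (- c * x\<^sup>2 / (2 * \<sigma>\<^sup>2)))"]) auto
  also have "\<dots> = (\<Prod>k\<in>I. ennreal (1 / sqrt (1 + c)))"
    by (simp only: nn_integral_centred_normal_exp_square[OF \<sigma> c])
  also have "\<dots> = ennreal ((1 / sqrt (1 + c)) ^ card I)"
    using c by (simp add: ennreal_power)
  finally show ?thesis .
qed

section \<open>Complex Gaussian sums\<close>

abbreviation (input) cnum :: "real \<Rightarrow> real \<Rightarrow> complex" where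
  "cnum a b \<equiv> complex_of_real a + \<i> * complex_of_real b"

text \<open>At a fixed t the ratio depends on the Gaussian vector only through these two sums. A
  general test function, rather than one event, lets inductions over I shift both arguments by the
  coordinate split off.\<close>

definition complex_normal_integral ::
    "'i set \<Rightarrow> real \<Rightarrow> ('i \<Rightarrow> complex) \<Rightarrow> (complex \<times> real \<Rightarrow> ennreal) \<Rightarrow> ennreal" where
  "complex_normal_integral I \<sigma> e f =
     (\<integral>\<^sup>+x. \<integral>\<^sup>+y. f (\<Sum>k\<in>I. cnum (x k) (y k) * e k, \<Sum>k\<in>I. (x k)\<^sup>2 + (y k)\<^sup>2)
        \<partial>isotropic_normal I \<sigma> \<partial>isotropic_normal I \<sigma>)"

lemma complex_normal_integral_insert:
  assumes \<sigma>: "0 < \<sigma>" and I: "finite I" "k \<notin> I"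
    and f[measurable]: "f \<in> borel_measurable (borel \<Otimes>\<^sub>M borel)"
  shows "complex_normal_integral (insert k I) \<sigma> e f =
    (\<integral>\<^sup>+a. \<integral>\<^sup>+b. complex_normal_integral I \<sigma> e (\<lambda>(z, r). f (z + cnum a b * e k, r + (a\<^sup>2 + b\<^sup>2)))
       \<partial>centred_normal \<sigma> \<partial>centred_normal \<sigma>)"
proof -
  interpret P: sigma_finite_measure "isotropic_normal I \<sigma>" by (rule sigma_finite_isotropic_normal[OF \<sigma> I(1)])
  interpret Q: sigma_finite_measure "isotropic_normal (insert k I) \<sigma>" using I by (intro sigma_finite_isotropic_normal[OF \<sigma>]) simp
  define h where "h a b = (\<lambda>(x, y). f ((\<Sum>j\<in>I. cnum (x j) (y j) * e j) + cnum a b * e k,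
    (\<Sum>j\<in>I. (x j)\<^sup>2 + (y j)\<^sup>2) + (a\<^sup>2 + b\<^sup>2)))" for a b
  have upd: "f (\<Sum>j\<in>insert k I. cnum ((x(k := a)) j) ((y(k := b)) j) * e j, \<Sum>j\<in>insert k I. ((x(k := a)) j)\<^sup>2 + ((y(k := b)) j)\<^sup>2)
     = h a b (x, y)" for x y a b
  proof -
    have "(\<Sum>j\<in>I. cnum ((x(k := a)) j) ((y(k := b)) j) * e j) = (\<Sum>j\<in>I. cnum (x j) (y j) * e j)"
      "(\<Sum>j\<in>I. ((x(k := a)) j)\<^sup>2 + ((y(k := b)) j)\<^sup>2) = (\<Sum>j\<in>I. (x j)\<^sup>2 + (y j)\<^sup>2)"
      using I by (auto intro!: sum.cong)
    then show ?thesis using I by (simp add: h_def add_ac)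
  qed
  have "complex_normal_integral (insert k I) \<sigma> e f
    = (\<integral>\<^sup>+a. \<integral>\<^sup>+x. \<integral>\<^sup>+y. f (\<Sum>j\<in>insert k I. cnum ((x(k := a)) j) (y j) * e j, \<Sum>j\<in>insert k I. ((x(k := a)) j)\<^sup>2 + (y j)\<^sup>2)
        \<partial>isotropic_normal (insert k I) \<sigma> \<partial>isotropic_normal I \<sigma> \<partial>centred_normal \<sigma>)"
    unfolding complex_normal_integral_def
    by (rule nn_integral_isotropic_normal_insert[OF \<sigma> I]) measurable
  also have "\<dots> = (\<integral>\<^sup>+a. \<integral>\<^sup>+x. \<integral>\<^sup>+b. \<integral>\<^sup>+y. h a b (x, y)
        \<partial>isotropic_normal I \<sigma> \<partial>centred_normal \<sigma> \<partial>isotropic_normal I \<sigma> \<partial>centred_normal \<sigma>)"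
  proof (rule nn_integral_cong, rule nn_integral_cong)
    fix a x
    show "(\<integral>\<^sup>+y. f (\<Sum>j\<in>insert k I. cnum ((x(k := a)) j) (y j) * e j, \<Sum>j\<in>insert k I. ((x(k := a)) j)\<^sup>2 + (y j)\<^sup>2)
        \<partial>isotropic_normal (insert k I) \<sigma>) = (\<integral>\<^sup>+b. \<integral>\<^sup>+y. h a b (x, y) \<partial>isotropic_normal I \<sigma> \<partial>centred_normal \<sigma>)"
      by (subst nn_integral_isotropic_normal_insert[OF \<sigma> I]) (measurable, simp only: upd)
  qed
  also have "\<dots> = (\<integral>\<^sup>+a. \<integral>\<^sup>+b. \<integral>\<^sup>+x. \<integral>\<^sup>+y. h a b (x, y)
        \<partial>isotropic_normal I \<sigma> \<partial>isotropic_normal I \<sigma> \<partial>centred_normal \<sigma> \<partial>centred_normal \<sigma>)"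
  proof (rule nn_integral_cong)
    fix a
    have m: "(\<lambda>(x, b). \<integral>\<^sup>+y. h a b (x, y) \<partial>isotropic_normal I \<sigma>) \<in> borel_measurable ((\<Pi>\<^sub>M k\<in>I. borel) \<Otimes>\<^sub>M borel)"
      unfolding h_def by measurable
    show "(\<integral>\<^sup>+x. \<integral>\<^sup>+b. \<integral>\<^sup>+y. h a b (x, y) \<partial>isotropic_normal I \<sigma> \<partial>centred_normal \<sigma> \<partial>isotropic_normal I \<sigma>)
      = (\<integral>\<^sup>+b. \<integral>\<^sup>+x. \<integral>\<^sup>+y. h a b (x, y) \<partial>isotropic_normal I \<sigma> \<partial>isotropic_normal I \<sigma> \<partial>centred_normal \<sigma>)"
      using nn_integral_isotropic_centred_normal_swap[OF \<sigma> I(1) m] by simp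
  qed
  finally show ?thesis unfolding complex_normal_integral_def h_def by simp
qed

text \<open>Multiplying a coordinate by a unimodular number rotates its real and imaginary parts,
  which preserves their joint law; the phases are removed one at a time. Hence the law of |F(t)|
  together with the norm does not depend on t.\<close>

lemma complex_normal_integral_phase:
  assumes \<sigma>: "0 < \<sigma>" and "finite I" and "\<And>k. k \<in> I \<Longrightarrow> cmod (e k) = 1"
    and f: "f \<in> borel_measurable (borel \<Otimes>\<^sub>M borel)"
  shows "complex_normal_integral I \<sigma> e f = complex_normal_integral I \<sigma> (\<lambda>_. 1) f"
  using assms(2-)
proof (induction I arbitrary: f rule: finite_induct)
  case empty
  then show ?case by (simp add: complex_normal_integral_def)
next
  case (insert k I f)
  note [measurable] = insert.prems(2)
  interpret P: sigma_finite_measure "isotropic_normal I \<sigma>" by (rule sigma_finite_isotropic_normal[OF \<sigma> insert.hyps(1)])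
  define H where "H = (\<lambda>(a, b). complex_normal_integral I \<sigma> (\<lambda>_. 1) (\<lambda>(z, r). f (z + cnum a b, r + (a\<^sup>2 + b\<^sup>2))))"
  have H: "H \<in> borel_measurable (borel \<Otimes>\<^sub>M borel)"
    unfolding H_def complex_normal_integral_def by measurable
  define c s where "c = Re (e k)" and "s = Im (e k)"
  have cs: "c\<^sup>2 + s\<^sup>2 = 1" using insert.prems(1)[of k] by (simp add: c_def s_def cmod_def)
  have rot: "cnum a b * e k = cnum (c * a - s * b) (s * a + c * b)" for a b
    by (simp add: complex_eq_iff c_def s_def algebra_simps)
  have sq: "a\<^sup>2 + b\<^sup>2 = (c * a - s * b)\<^sup>2 + (s * a + c * b)\<^sup>2" for a b
  proof -
    have "(c * a - s * b)\<^sup>2 + (s * a + c * b)\<^sup>2 = (c\<^sup>2 + s\<^sup>2) * (a\<^sup>2 + b\<^sup>2)"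
      by (simp add: algebra_simps power2_eq_square)
    then show ?thesis using cs by simp
  qed
  have IH: "complex_normal_integral I \<sigma> e (\<lambda>(z, r). f (z + cnum a b * e k, r + (a\<^sup>2 + b\<^sup>2)))
     = H (c * a - s * b, s * a + c * b)" for a b
  proof -
    have "complex_normal_integral I \<sigma> e (\<lambda>(z, r). f (z + cnum a b * e k, r + (a\<^sup>2 + b\<^sup>2)))
      = complex_normal_integral I \<sigma> (\<lambda>_. 1) (\<lambda>(z, r). f (z + cnum a b * e k, r + (a\<^sup>2 + b\<^sup>2)))"
      by (rule insert.IH) (use insert.prems(1) in simp, measurable)
    then show ?thesis unfolding H_def prod.case rot sq[of a b] .
  qed
  have "complex_normal_integral (insert k I) \<sigma> e f
     = (\<integral>\<^sup>+a. \<integral>\<^sup>+b. H (c * a - s * b, s * a + c * b) \<partial>centred_normal \<sigma> \<partial>centred_normal \<sigma>)"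
    unfolding complex_normal_integral_insert[OF \<sigma> insert.hyps insert.prems(2)] IH ..
  also have "\<dots> = (\<integral>\<^sup>+a. \<integral>\<^sup>+b. H (a, b) \<partial>centred_normal \<sigma> \<partial>centred_normal \<sigma>)"
    by (rule nn_integral_centred_normal_rotation[OF H cs])
  also have "\<dots> = complex_normal_integral (insert k I) \<sigma> (\<lambda>_. 1) f"
    unfolding complex_normal_integral_insert[OF \<sigma> insert.hyps insert.prems(2)] H_def by simp
  finally show ?case .
qed

text \<open>The real and imaginary parts are rotated separately, and the integrals are then
  reordered so that a and b are innermost. For them the planar tail is known, and the other
  coordinates enter only through their sum of squares.\<close>

lemma complex_normal_integral_sum:
  assumes \<sigma>: "0 < \<sigma>" and I: "finite I" "i \<notin> I"
    and f[measurable]: "f \<in> borel_measurable (borel \<Otimes>\<^sub>M borel)"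
  shows "complex_normal_integral (insert i I) \<sigma> (\<lambda>_. 1) f =
    (\<integral>\<^sup>+y. \<integral>\<^sup>+x. \<integral>\<^sup>+b. \<integral>\<^sup>+a. f (of_real (sqrt (real (card I + 1))) * cnum a b,
        a\<^sup>2 + b\<^sup>2 + ((\<Sum>k\<in>I. (x k)\<^sup>2) + (\<Sum>k\<in>I. (y k)\<^sup>2)))
       \<partial>centred_normal \<sigma> \<partial>centred_normal \<sigma> \<partial>isotropic_normal I \<sigma> \<partial>isotropic_normal I \<sigma>)"
proof -
  define J where "J = insert i I"
  have J: "finite J" using I by (simp add: J_def)
  define q where "q = sqrt (real (card I + 1))"
  interpret P: sigma_finite_measure "isotropic_normal I \<sigma>" by (rule sigma_finite_isotropic_normal[OF \<sigma> I(1)])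
  interpret Q: sigma_finite_measure "isotropic_normal J \<sigma>" by (rule sigma_finite_isotropic_normal[OF \<sigma> J])
  interpret N: prob_space "centred_normal \<sigma>" by (rule prob_space_centred_normal[OF \<sigma>])
  have "complex_normal_integral J \<sigma> (\<lambda>_. 1) f = (\<integral>\<^sup>+x. \<integral>\<^sup>+y. f (cnum (\<Sum>k\<in>J. x k) (\<Sum>k\<in>J. y k), (\<Sum>k\<in>J. (x k)\<^sup>2) + (\<Sum>k\<in>J. (y k)\<^sup>2))
        \<partial>isotropic_normal J \<sigma> \<partial>isotropic_normal J \<sigma>)"
    unfolding complex_normal_integral_def by (simp add: sum.distrib sum_distrib_left)
  also have "\<dots> = (\<integral>\<^sup>+x. \<integral>\<^sup>+b. \<integral>\<^sup>+y. f (cnum (\<Sum>k\<in>J. x k) (q * b), (\<Sum>k\<in>J. (x k)\<^sup>2) + (b\<^sup>2 + (\<Sum>k\<in>I. (y k)\<^sup>2)))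
        \<partial>isotropic_normal I \<sigma> \<partial>centred_normal \<sigma> \<partial>isotropic_normal J \<sigma>)"
  proof (rule nn_integral_cong)
    fix x :: "'a \<Rightarrow> real"
    have "(\<lambda>(s, r). f (cnum (\<Sum>k\<in>J. x k) s, (\<Sum>k\<in>J. (x k)\<^sup>2) + r)) \<in> borel_measurable (borel \<Otimes>\<^sub>M borel)" by measurable
    from nn_integral_isotropic_normal_sum[OF \<sigma> I this]
    show "(\<integral>\<^sup>+y. f (cnum (\<Sum>k\<in>J. x k) (\<Sum>k\<in>J. y k), (\<Sum>k\<in>J. (x k)\<^sup>2) + (\<Sum>k\<in>J. (y k)\<^sup>2)) \<partial>isotropic_normal J \<sigma>)
      = (\<integral>\<^sup>+b. \<integral>\<^sup>+y. f (cnum (\<Sum>k\<in>J. x k) (q * b), (\<Sum>k\<in>J. (x k)\<^sup>2) + (b\<^sup>2 + (\<Sum>k\<in>I. (y k)\<^sup>2)))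
          \<partial>isotropic_normal I \<sigma> \<partial>centred_normal \<sigma>)"
      unfolding J_def q_def prod.case .
  qed
  also have "\<dots> = (\<integral>\<^sup>+b. \<integral>\<^sup>+x. \<integral>\<^sup>+y. f (cnum (\<Sum>k\<in>J. x k) (q * b), (\<Sum>k\<in>J. (x k)\<^sup>2) + (b\<^sup>2 + (\<Sum>k\<in>I. (y k)\<^sup>2)))
        \<partial>isotropic_normal I \<sigma> \<partial>isotropic_normal J \<sigma> \<partial>centred_normal \<sigma>)"
    by (rule nn_integral_isotropic_centred_normal_swap[OF \<sigma> J, of "\<lambda>(x, b). \<integral>\<^sup>+y. f (cnum (\<Sum>k\<in>J. x k) (q * b), (\<Sum>k\<in>J. (x k)\<^sup>2) + (b\<^sup>2 + (\<Sum>k\<in>I. (y k)\<^sup>2)))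
        \<partial>isotropic_normal I \<sigma>", unfolded prod.case]) measurable
  \<comment> \<open>The rotation of the sum is applied to an innermost vector, so x has to be moved
    inside first.\<close>
  also have "\<dots> = (\<integral>\<^sup>+b. \<integral>\<^sup>+y. \<integral>\<^sup>+x. f (cnum (\<Sum>k\<in>J. x k) (q * b), (\<Sum>k\<in>J. (x k)\<^sup>2) + (b\<^sup>2 + (\<Sum>k\<in>I. (y k)\<^sup>2)))
        \<partial>isotropic_normal J \<sigma> \<partial>isotropic_normal I \<sigma> \<partial>centred_normal \<sigma>)"
  proof (rule nn_integral_cong)
    fix b
    have "(\<lambda>(x, y). f (cnum (\<Sum>k\<in>J. x k) (q * b), (\<Sum>k\<in>J. (x k)\<^sup>2) + (b\<^sup>2 + (\<Sum>k\<in>I. (y k)\<^sup>2))))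
      \<in> borel_measurable ((\<Pi>\<^sub>M k\<in>J. borel) \<Otimes>\<^sub>M (\<Pi>\<^sub>M k\<in>I. borel))" by measurable
    from nn_integral_isotropic_normal_swap[OF \<sigma> J I(1) this]
    show "(\<integral>\<^sup>+x. \<integral>\<^sup>+y. f (cnum (\<Sum>k\<in>J. x k) (q * b), (\<Sum>k\<in>J. (x k)\<^sup>2) + (b\<^sup>2 + (\<Sum>k\<in>I. (y k)\<^sup>2)))
        \<partial>isotropic_normal I \<sigma> \<partial>isotropic_normal J \<sigma>)
      = (\<integral>\<^sup>+y. \<integral>\<^sup>+x. f (cnum (\<Sum>k\<in>J. x k) (q * b), (\<Sum>k\<in>J. (x k)\<^sup>2) + (b\<^sup>2 + (\<Sum>k\<in>I. (y k)\<^sup>2)))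
        \<partial>isotropic_normal J \<sigma> \<partial>isotropic_normal I \<sigma>)"
      unfolding prod.case .
  qed
  also have "\<dots> = (\<integral>\<^sup>+b. \<integral>\<^sup>+y. \<integral>\<^sup>+a. \<integral>\<^sup>+x. f (cnum (q * a) (q * b), a\<^sup>2 + (\<Sum>k\<in>I. (x k)\<^sup>2) + (b\<^sup>2 + (\<Sum>k\<in>I. (y k)\<^sup>2)))
        \<partial>isotropic_normal I \<sigma> \<partial>centred_normal \<sigma> \<partial>isotropic_normal I \<sigma> \<partial>centred_normal \<sigma>)"
  proof (rule nn_integral_cong, rule nn_integral_cong)
    fix b and y :: "'a \<Rightarrow> real"
    have "(\<lambda>(s, r). f (cnum s (q * b), r + (b\<^sup>2 + (\<Sum>k\<in>I. (y k)\<^sup>2)))) \<in> borel_measurable (borel \<Otimes>\<^sub>M borel)" by measurable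
    from nn_integral_isotropic_normal_sum[OF \<sigma> I this]
    show "(\<integral>\<^sup>+x. f (cnum (\<Sum>k\<in>J. x k) (q * b), (\<Sum>k\<in>J. (x k)\<^sup>2) + (b\<^sup>2 + (\<Sum>k\<in>I. (y k)\<^sup>2))) \<partial>isotropic_normal J \<sigma>)
      = (\<integral>\<^sup>+a. \<integral>\<^sup>+x. f (cnum (q * a) (q * b), a\<^sup>2 + (\<Sum>k\<in>I. (x k)\<^sup>2) + (b\<^sup>2 + (\<Sum>k\<in>I. (y k)\<^sup>2)))
        \<partial>isotropic_normal I \<sigma> \<partial>centred_normal \<sigma>)"
      unfolding J_def q_def prod.case .
  qed
  \<comment> \<open>The remaining exchanges only move a and b inwards.\<close>
  also have "\<dots> = (\<integral>\<^sup>+b. \<integral>\<^sup>+y. \<integral>\<^sup>+x. \<integral>\<^sup>+a. f (cnum (q * a) (q * b), a\<^sup>2 + (\<Sum>k\<in>I. (x k)\<^sup>2) + (b\<^sup>2 + (\<Sum>k\<in>I. (y k)\<^sup>2)))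
        \<partial>centred_normal \<sigma> \<partial>isotropic_normal I \<sigma> \<partial>isotropic_normal I \<sigma> \<partial>centred_normal \<sigma>)"
  proof (rule nn_integral_cong, rule nn_integral_cong)
    fix b and y :: "'a \<Rightarrow> real"
    have "(\<lambda>(x, a). f (cnum (q * a) (q * b), a\<^sup>2 + (\<Sum>k\<in>I. (x k)\<^sup>2) + (b\<^sup>2 + (\<Sum>k\<in>I. (y k)\<^sup>2))))
      \<in> borel_measurable ((\<Pi>\<^sub>M k\<in>I. borel) \<Otimes>\<^sub>M borel)" by measurable
    from nn_integral_isotropic_centred_normal_swap[OF \<sigma> I(1) this, symmetric]
    show "(\<integral>\<^sup>+a. \<integral>\<^sup>+x. f (cnum (q * a) (q * b), a\<^sup>2 + (\<Sum>k\<in>I. (x k)\<^sup>2) + (b\<^sup>2 + (\<Sum>k\<in>I. (y k)\<^sup>2)))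
        \<partial>isotropic_normal I \<sigma> \<partial>centred_normal \<sigma>)
      = (\<integral>\<^sup>+x. \<integral>\<^sup>+a. f (cnum (q * a) (q * b), a\<^sup>2 + (\<Sum>k\<in>I. (x k)\<^sup>2) + (b\<^sup>2 + (\<Sum>k\<in>I. (y k)\<^sup>2)))
        \<partial>centred_normal \<sigma> \<partial>isotropic_normal I \<sigma>)"
      unfolding prod.case .
  qed
  also have "\<dots> = (\<integral>\<^sup>+y. \<integral>\<^sup>+b. \<integral>\<^sup>+x. \<integral>\<^sup>+a. f (cnum (q * a) (q * b), a\<^sup>2 + (\<Sum>k\<in>I. (x k)\<^sup>2) + (b\<^sup>2 + (\<Sum>k\<in>I. (y k)\<^sup>2)))
        \<partial>centred_normal \<sigma> \<partial>isotropic_normal I \<sigma> \<partial>centred_normal \<sigma> \<partial>isotropic_normal I \<sigma>)"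
    by (rule nn_integral_isotropic_centred_normal_swap[OF \<sigma> I(1), of "\<lambda>(y, b). \<integral>\<^sup>+x. \<integral>\<^sup>+a. f (cnum (q * a) (q * b), a\<^sup>2 + (\<Sum>k\<in>I. (x k)\<^sup>2) + (b\<^sup>2 + (\<Sum>k\<in>I. (y k)\<^sup>2)))
        \<partial>centred_normal \<sigma> \<partial>isotropic_normal I \<sigma>", unfolded prod.case, symmetric]) measurable
  also have "\<dots> = (\<integral>\<^sup>+y. \<integral>\<^sup>+x. \<integral>\<^sup>+b. \<integral>\<^sup>+a. f (cnum (q * a) (q * b), a\<^sup>2 + (\<Sum>k\<in>I. (x k)\<^sup>2) + (b\<^sup>2 + (\<Sum>k\<in>I. (y k)\<^sup>2)))
        \<partial>centred_normal \<sigma> \<partial>centred_normal \<sigma> \<partial>isotropic_normal I \<sigma> \<partial>isotropic_normal I \<sigma>)"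
  proof (rule nn_integral_cong)
    fix y :: "'a \<Rightarrow> real"
    have "(\<lambda>(x, b). \<integral>\<^sup>+a. f (cnum (q * a) (q * b), a\<^sup>2 + (\<Sum>k\<in>I. (x k)\<^sup>2) + (b\<^sup>2 + (\<Sum>k\<in>I. (y k)\<^sup>2))) \<partial>centred_normal \<sigma>)
      \<in> borel_measurable ((\<Pi>\<^sub>M k\<in>I. borel) \<Otimes>\<^sub>M borel)" by measurable
    from nn_integral_isotropic_centred_normal_swap[OF \<sigma> I(1) this, symmetric]
    show "(\<integral>\<^sup>+b. \<integral>\<^sup>+x. \<integral>\<^sup>+a. f (cnum (q * a) (q * b), a\<^sup>2 + (\<Sum>k\<in>I. (x k)\<^sup>2) + (b\<^sup>2 + (\<Sum>k\<in>I. (y k)\<^sup>2)))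
        \<partial>centred_normal \<sigma> \<partial>isotropic_normal I \<sigma> \<partial>centred_normal \<sigma>)
      = (\<integral>\<^sup>+x. \<integral>\<^sup>+b. \<integral>\<^sup>+a. f (cnum (q * a) (q * b), a\<^sup>2 + (\<Sum>k\<in>I. (x k)\<^sup>2) + (b\<^sup>2 + (\<Sum>k\<in>I. (y k)\<^sup>2)))
        \<partial>centred_normal \<sigma> \<partial>centred_normal \<sigma> \<partial>isotropic_normal I \<sigma>)"
      unfolding prod.case .
  qed
  finally show ?thesis by (simp add: J_def q_def algebra_simps)
qed

text \<open>With R the sum of squares of the other coordinates, the event is a^2 + b^2 >= c R for c
  = w/(1 - w). Given R its probability is exp(-c R/(2 \<sigma>^2)). R is a sum of 2(n - 1) squares,
  so averaging gives (1 + c)^(-(n - 1)) = (1 - w)^(n - 1).\<close>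

lemma complex_normal_ratio_tail:
  fixes w :: real
  assumes \<sigma>: "0 < \<sigma>" and I: "finite I" "I \<noteq> {}" and e: "\<And>k. k \<in> I \<Longrightarrow> cmod (e k) = 1"
    and w: "0 \<le> w" "w < 1"
  shows "complex_normal_integral I \<sigma> e (\<lambda>(z, r). indicator {w * real (card I) * r..} ((cmod z)\<^sup>2))
    = ennreal ((1 - w) ^ (card I - 1))"
proof -
  obtain i J where J: "I = insert i J" "i \<notin> J" "finite J"
    using I by (metis all_not_in_conv finite_insert mk_disjoint_insert)
  define n where "n = card J + 1"
  define c where "c = w / (1 - w)"
  have c: "0 \<le> c" "1 + c = 1 / (1 - w)" using w by (auto simp: c_def field_simps)
  have n: "card I = n" "0 < n" using J by (auto simp: n_def)
  interpret P: sigma_finite_measure "isotropic_normal J \<sigma>" by (rule sigma_finite_isotropic_normal[OF \<sigma> J(3)])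
  define f :: "complex \<times> real \<Rightarrow> ennreal" where "f = (\<lambda>(z, r). indicator {w * real n * r..} ((cmod z)\<^sup>2))"
  have f: "f \<in> borel_measurable (borel \<Otimes>\<^sub>M borel)" unfolding f_def indicator_def atLeast_iff by measurable
  have inner: "(\<integral>\<^sup>+b. \<integral>\<^sup>+a. f (of_real (sqrt (real n)) * cnum a b, a\<^sup>2 + b\<^sup>2 + R) \<partial>centred_normal \<sigma> \<partial>centred_normal \<sigma>)
    = ennreal (exp (- c * R / (2 * \<sigma>\<^sup>2)))" if "0 \<le> R" for R
  proof -
    have "f (of_real (sqrt (real n)) * cnum a b, a\<^sup>2 + b\<^sup>2 + R) = indicator {c * R..} (b\<^sup>2 + a\<^sup>2)" for a b
    proof -
      have "cmod (cnum a b) = sqrt (a\<^sup>2 + b\<^sup>2)" by (simp add: cmod_def)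
      then have z: "(cmod (of_real (sqrt (real n)) * cnum a b))\<^sup>2 = real n * (a\<^sup>2 + b\<^sup>2)"
        by (simp only: norm_mult power_mult_distrib) simp
      have "w * real n * (a\<^sup>2 + b\<^sup>2 + R) \<le> real n * (a\<^sup>2 + b\<^sup>2) \<longleftrightarrow> real n * (w * (a\<^sup>2 + b\<^sup>2 + R)) \<le> real n * (a\<^sup>2 + b\<^sup>2)"
        by (simp add: mult_ac)
      also have "\<dots> \<longleftrightarrow> w * (a\<^sup>2 + b\<^sup>2 + R) \<le> a\<^sup>2 + b\<^sup>2" using n by simp
      also have "\<dots> \<longleftrightarrow> c * R \<le> b\<^sup>2 + a\<^sup>2"
        using w by (simp add: c_def divide_le_eq algebra_simps)
      finally show ?thesis unfolding f_def prod.case z by (simp add: indicator_def)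
    qed
    then show ?thesis using centred_normal_pair_tail[OF \<sigma>, of "c * R"] c that by simp
  qed
  have "complex_normal_integral I \<sigma> e f = complex_normal_integral I \<sigma> (\<lambda>_. 1) f"
    by (rule complex_normal_integral_phase[OF \<sigma> I(1) e f])
  also have "\<dots> = (\<integral>\<^sup>+y. \<integral>\<^sup>+x. ennreal (exp (- c * ((\<Sum>k\<in>J. (x k)\<^sup>2) + (\<Sum>k\<in>J. (y k)\<^sup>2)) / (2 * \<sigma>\<^sup>2)))
      \<partial>isotropic_normal J \<sigma> \<partial>isotropic_normal J \<sigma>)"
    unfolding J(1) complex_normal_integral_sum[OF \<sigma> J(3,2) f] n_def[symmetric]
    by (simp add: inner sum_nonneg)
  also have "\<dots> = (\<integral>\<^sup>+y. ennreal (exp (- c * (\<Sum>k\<in>J. (y k)\<^sup>2) / (2 * \<sigma>\<^sup>2))) *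
      (\<integral>\<^sup>+x. ennreal (exp (- c * (\<Sum>k\<in>J. (x k)\<^sup>2) / (2 * \<sigma>\<^sup>2))) \<partial>isotropic_normal J \<sigma>) \<partial>isotropic_normal J \<sigma>)"
  proof (rule nn_integral_cong)
    fix y :: "'a \<Rightarrow> real"
    have "ennreal (exp (- c * ((\<Sum>k\<in>J. (x k)\<^sup>2) + (\<Sum>k\<in>J. (y k)\<^sup>2)) / (2 * \<sigma>\<^sup>2)))
      = ennreal (exp (- c * (\<Sum>k\<in>J. (y k)\<^sup>2) / (2 * \<sigma>\<^sup>2))) * ennreal (exp (- c * (\<Sum>k\<in>J. (x k)\<^sup>2) / (2 * \<sigma>\<^sup>2)))" for x
      unfolding ennreal_mult[OF exp_ge_zero exp_ge_zero, symmetric] exp_add[symmetric]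
      by (simp add: add_divide_distrib[symmetric] algebra_simps)
    then show "(\<integral>\<^sup>+x. ennreal (exp (- c * ((\<Sum>k\<in>J. (x k)\<^sup>2) + (\<Sum>k\<in>J. (y k)\<^sup>2)) / (2 * \<sigma>\<^sup>2))) \<partial>isotropic_normal J \<sigma>)
      = ennreal (exp (- c * (\<Sum>k\<in>J. (y k)\<^sup>2) / (2 * \<sigma>\<^sup>2))) *
        (\<integral>\<^sup>+x. ennreal (exp (- c * (\<Sum>k\<in>J. (x k)\<^sup>2) / (2 * \<sigma>\<^sup>2))) \<partial>isotropic_normal J \<sigma>)"
      by (simp only:) (rule nn_integral_cmult, measurable)
  qed
  also have "\<dots> = ennreal ((1 / sqrt (1 + c)) ^ card J) * ennreal ((1 / sqrt (1 + c)) ^ card J)"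
    unfolding nn_integral_isotropic_normal_exp_square[OF \<sigma> J(3) c(1)]
    by (subst nn_integral_multc) (measurable, simp only: nn_integral_isotropic_normal_exp_square[OF \<sigma> J(3) c(1)])
  \<comment> \<open>Real and imaginary parts contribute one factor each, and the two square roots
    combine.\<close>
  also have "\<dots> = ennreal ((1 / sqrt (1 + c) * (1 / sqrt (1 + c))) ^ card J)"
    unfolding power_mult_distrib using c(1) by (intro ennreal_mult[symmetric]) auto
  also have "1 / sqrt (1 + c) * (1 / sqrt (1 + c)) = 1 - w"
    unfolding c(2) using w by (simp add: real_sqrt_mult[symmetric])
  finally show ?thesis unfolding f_def n by (simp add: n_def)
qed

section \<open>The supremum\<close>

lemma herm_norm_square: "(herm_norm m (\<lambda>k. cnum (x k) (y k)))\<^sup>2 = (\<Sum>k\<in>freqs m. (x k)\<^sup>2 + (y k)\<^sup>2)"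
  unfolding herm_norm_def L2_set_def by (simp add: sum_nonneg cmod_def)

text \<open>Translation and reflection carry (0, D] to the two sides of t. For every \<delta> at
  least one image lies in G, and the two sides are disjoint, so nothing is counted twice.\<close>

lemma near_maximum_measure:
  fixes G :: "real set"
  assumes G[measurable]: "G \<in> sets borel" and D: "0 \<le> D"
    and near: "\<And>\<delta>. 0 < \<delta> \<Longrightarrow> \<delta> \<le> D \<Longrightarrow> t + \<delta> \<in> G \<or> t - \<delta> \<in> G"
  shows "ennreal D \<le> (\<integral>\<^sup>+s. indicator (G \<inter> {t - D..t + D}) s \<partial>lborel)"
proof -
  define \<phi> :: "real \<Rightarrow> ennreal" where "\<phi> = indicator (G \<inter> {t<..t + D})"
  define \<psi> :: "real \<Rightarrow> ennreal" where "\<psi> = indicator (G \<inter> {t - D..<t})"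
  have [measurable]: "\<phi> \<in> borel_measurable borel" "\<psi> \<in> borel_measurable borel"
    unfolding \<phi>_def \<psi>_def by measurable
  have "ennreal D = (\<integral>\<^sup>+\<delta>. indicator {0<..D} \<delta> \<partial>lborel)" using D by simp
  also have "\<dots> \<le> (\<integral>\<^sup>+\<delta>. \<phi> (t + 1 * \<delta>) + \<psi> (t + (-1) * \<delta>) \<partial>lborel)"
    using near by (intro nn_integral_mono) (fastforce simp: \<phi>_def \<psi>_def indicator_def)
  also have "\<dots> = (\<integral>\<^sup>+\<delta>. \<phi> (t + 1 * \<delta>) \<partial>lborel) + (\<integral>\<^sup>+\<delta>. \<psi> (t + (-1) * \<delta>) \<partial>lborel)"
    by (rule nn_integral_add) measurable
  also have "\<dots> = (\<integral>\<^sup>+s. \<phi> s \<partial>lborel) + (\<integral>\<^sup>+s. \<psi> s \<partial>lborel)"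
    using nn_integral_real_affine[of \<phi> 1 t] nn_integral_real_affine[of \<psi> "-1" t] by simp
  also have "\<dots> = (\<integral>\<^sup>+s. \<phi> s + \<psi> s \<partial>lborel)" by (rule nn_integral_add[symmetric]) measurable
  also have "\<dots> \<le> (\<integral>\<^sup>+s. indicator (G \<inter> {t - D..t + D}) s \<partial>lborel)"
    by (intro nn_integral_mono) (auto simp: \<phi>_def \<psi>_def indicator_def)
  finally show ?thesis .
qed

text \<open>The good points lie within D of a maximiser, whose position depends on c; enlarging to
  the fixed window gives an integral to which Fubini's theorem applies when c is random.\<close>

lemma sup_norm_exceeds_measure:
  fixes m :: nat and u :: real
  assumes m: "1 \<le> m" and u: "0 < u"
    and ex: "u < sup_norm (dual_fourier m c) / (sqrt (real n) * herm_norm m c)"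
  shows "ennreal (1 / (24 * real m)) \<le>
    (\<integral>\<^sup>+t. indicator {- (1 / (24 * real m))..1 + 1 / (24 * real m)} t *
         indicator {(cos (pi / 12) * u)\<^sup>2 * real n * (herm_norm m c)\<^sup>2..} ((cmod (dual_fourier m c t))\<^sup>2) \<partial>lborel)"
proof -
  define D where "D = 1 / (24 * real m)"
  define B where "B = sup_norm (dual_fourier m c)"
  define K where "K = sqrt (real n) * herm_norm m c"
  define G where "G = {t. (cos (pi / 12) * u)\<^sup>2 * real n * (herm_norm m c)\<^sup>2 \<le> (cmod (dual_fourier m c t))\<^sup>2}"
  have \<kappa>: "0 < cos (pi / 12)" by (rule cos_gt_zero) auto
  have K0: "0 \<le> K" unfolding K_def herm_norm_def by (simp add: L2_set_nonneg)
  \<comment> \<open>Division by 0 yields 0, which does not exceed u.\<close>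
  moreover have "K \<noteq> 0" using ex u unfolding K_def[symmetric] by auto
  ultimately have uK: "u * K < B"
    using ex unfolding K_def[symmetric] B_def[symmetric] by (simp add: pos_less_divide_eq)
  obtain t where t: "t \<in> {0..1}" "cmod (dual_fourier m c t) = B"
    unfolding B_def using sup_norm_dual_fourier_attained[of m c] by blast
  have "continuous_on UNIV (dual_fourier m c)" by (rule continuous_on_dual_fourier)
  then have [measurable]: "dual_fourier m c \<in> borel_measurable borel" by (rule borel_measurable_continuous_onI)
  have G: "G \<in> sets borel" unfolding G_def by measurable
  have in_G: "s \<in> G" if "cos (pi / 12) * B \<le> cmod (dual_fourier m c s)" for s
  proof -
    have "cos (pi / 12) * (u * K) \<le> cmod (dual_fourier m c s)"
      using uK \<kappa> that by (meson less_imp_le mult_left_mono order_trans)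
    then have "(cos (pi / 12) * (u * K))\<^sup>2 \<le> (cmod (dual_fourier m c s))\<^sup>2"
      using \<kappa> u K0 by (intro power_mono) auto
    then show ?thesis by (simp add: G_def K_def power_mult_distrib mult_ac)
  qed
  have "t + \<delta> \<in> G \<or> t - \<delta> \<in> G" if \<delta>: "0 < \<delta>" "\<delta> \<le> D" for \<delta>
  proof -
    have "real m * \<delta> \<le> real m * D" using \<delta> by (intro mult_left_mono) auto
    then have "2 * pi * (real m * \<delta>) \<le> 2 * pi * (real m * D)" by (rule mult_left_mono) auto
    also have "2 * pi * (real m * D) = pi / 12" using m by (simp add: D_def)
    finally have le: "2 * pi * real m * \<delta> \<le> pi / 12" by (simp only: mult.assoc)
    have "0 \<le> B" unfolding t(2)[symmetric] by simp
    moreover have "cos (pi / 12) \<le> cos (2 * pi * real m * \<delta>)"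
      using le \<delta> m by (intro cos_monotone_0_pi_le) auto
    ultimately have "cos (pi / 12) * B \<le> cos (2 * pi * real m * \<delta>) * B" by (rule mult_right_mono[rotated])
    also have "\<dots> \<le> max (cmod (dual_fourier m c (t + \<delta>))) (cmod (dual_fourier m c (t - \<delta>)))"
      unfolding B_def using m \<delta> le t(2) pi_gt_zero by (intro dual_fourier_near_maximum) (auto simp: B_def)
    finally show ?thesis using in_G by (auto simp: le_max_iff_disj)
  qed
  then have "ennreal D \<le> (\<integral>\<^sup>+s. indicator (G \<inter> {t - D..t + D}) s \<partial>lborel)"
    by (intro near_maximum_measure G) (auto simp: D_def)
  also have "\<dots> \<le> (\<integral>\<^sup>+t. indicator {- D..1 + D} t * indicator {(cos (pi / 12) * u)\<^sup>2 * real n * (herm_norm m c)\<^sup>2..} ((cmod (dual_fourier m c t))\<^sup>2) \<partial>lborel)"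
    using t by (intro nn_integral_mono) (auto simp: G_def indicator_def)
  finally show ?thesis unfolding D_def .
qed

lemma cos_pi_12_square: "93/100 \<le> (cos (pi / 12))\<^sup>2"
proof -
  have "cos (pi / 6) = 2 * (cos (pi / 12))\<^sup>2 - 1"
    using cos_double_cos[of "pi / 12"] by simp
  moreover have "86/100 \<le> sqrt 3 / 2"
  proof -
    have "172/100 \<le> sqrt 3" by (rule real_le_rsqrt) (simp add: power2_eq_square)
    then show ?thesis by simp
  qed
  ultimately show ?thesis by (simp add: cos_30)
qed

theorem lemma19:
  fixes M :: "'a measure"
    and fc n :: nat
    and \<sigma>\<^sub>0 :: real
    and \<epsilon>1 \<epsilon>2 :: "'a \<Rightarrow> int \<Rightarrow> real"
    and \<epsilon> :: "'a \<Rightarrow> int \<Rightarrow> complex"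
  assumes "prob_space M"
    and "fc \<ge> 1"
    and "n = 2 * fc + 1"
    and "\<sigma>\<^sub>0 > 0"
    and "prob_space.indep_var M
           (\<Pi>\<^sub>M k\<in>freqs fc. borel) \<epsilon>1 (\<Pi>\<^sub>M k\<in>freqs fc. borel) \<epsilon>2"
    and "distr M (\<Pi>\<^sub>M k\<in>freqs fc. borel) \<epsilon>1 = isotropic_normal (freqs fc) \<sigma>\<^sub>0"
    and "distr M (\<Pi>\<^sub>M k\<in>freqs fc. borel) \<epsilon>2 = isotropic_normal (freqs fc) \<sigma>\<^sub>0"
    and "\<And>\<omega> k. \<epsilon> \<omega> k = complex_of_real (\<epsilon>1 \<omega> k) + \<i> * complex_of_real (\<epsilon>2 \<omega> k)"
  shows "(\<forall>u::real. 0 < u \<and> u \<le> 1 \<longrightarrow>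
            measure M {\<omega> \<in> space M.
              sup_norm (dual_fourier fc (\<epsilon> \<omega>)) / (sqrt (real n) * herm_norm fc (\<epsilon> \<omega>)) > u}
            \<le> (2 * sqrt 2 + 2 * real n / sqrt 3) * (1 - u\<^sup>2 / 2) ^ n)
       \<and> (AE \<omega> in M.
            sup_norm (dual_fourier fc (\<epsilon> \<omega>)) / (sqrt (real n) * herm_norm fc (\<epsilon> \<omega>)) \<le> sqrt 2)"
proof -
  interpret prob_space M by fact
  let ?P = "\<Pi>\<^sub>M k\<in>freqs fc. borel :: real measure"
  let ?ratio = "\<lambda>\<omega>. sup_norm (dual_fourier fc (\<epsilon> \<omega>)) / (sqrt (real n) * herm_norm fc (\<epsilon> \<omega>))"
  have \<epsilon>: "\<epsilon> \<omega> = (\<lambda>k. cnum (\<epsilon>1 \<omega> k) (\<epsilon>2 \<omega> k))" for \<omega> using assms(8) by auto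
  have rv[measurable]: "\<epsilon>1 \<in> M \<rightarrow>\<^sub>M ?P" "\<epsilon>2 \<in> M \<rightarrow>\<^sub>M ?P"
    and joint: "isotropic_normal (freqs fc) \<sigma>\<^sub>0 \<Otimes>\<^sub>M isotropic_normal (freqs fc) \<sigma>\<^sub>0
      = distr M (?P \<Otimes>\<^sub>M ?P) (\<lambda>\<omega>. (\<epsilon>1 \<omega>, \<epsilon>2 \<omega>))"
    using assms(5) unfolding indep_var_distribution_eq assms(6,7) by auto
  have card: "card (freqs fc) = n" using assms(3) by (simp add: card_freqs)
  have ne: "freqs fc \<noteq> {}" by (simp add: freqs_def)
  interpret N: sigma_finite_measure "isotropic_normal (freqs fc) \<sigma>\<^sub>0"
    by (rule sigma_finite_isotropic_normal[OF assms(4)]) simp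
  have cis[measurable]: "cis \<in> borel_measurable borel"
    by (intro borel_measurable_continuous_onI continuous_intros)
  have "measure M {\<omega> \<in> space M. ?ratio \<omega> > u} \<le> (2 * sqrt 2 + 2 * real n / sqrt 3) * (1 - u\<^sup>2 / 2) ^ n"
    if u: "0 < u" "u \<le> 1" for u
  proof -
    define A where "A = {\<omega> \<in> space M. ?ratio \<omega> > u}"
    define D where "D = 1 / (24 * real fc)"
    define w where "w = (cos (pi / 12) * u)\<^sup>2"
    have D: "0 < D" using assms(2) by (simp add: D_def)
    \<comment> \<open>Together with cos(pi/12)^2 < 1 this gives w < 1 even at u = 1, as the exact
      tail formula requires.\<close>
    have w_le: "w \<le> (cos (pi / 12))\<^sup>2"
      using u by (simp add: w_def power_mult_distrib mult_left_le power_le_one)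
    have "(cos (pi / 12))\<^sup>2 < 1"
    proof -
      have "0 < sin (pi / 12)" by (rule sin_gt_zero) auto
      then have "0 < (sin (pi / 12))\<^sup>2" by (rule zero_less_power)
      then show ?thesis using sin_cos_squared_add[of "pi / 12"] by linarith
    qed
    then have w: "0 \<le> w" "w < 1" using w_le by (auto simp: w_def)
    \<comment> \<open>The event at a fixed t as a function on the space of pairs of real vectors:
      jointly measurable with t, and integrable against the joint law.\<close>
    define h where "h = (\<lambda>((x, y), t). indicator {w * real n * (\<Sum>k\<in>freqs fc. (x k)\<^sup>2 + (y k)\<^sup>2)..}
        ((cmod (\<Sum>k\<in>freqs fc. cnum (x k) (y k) * cis (2 * pi * real_of_int k * t)))\<^sup>2) :: ennreal)"
    have h[measurable]: "h \<in> borel_measurable ((?P \<Otimes>\<^sub>M ?P) \<Otimes>\<^sub>M borel)"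
      unfolding h_def indicator_def atLeast_iff case_prod_beta by measurable
    have h_eq: "h ((\<epsilon>1 \<omega>, \<epsilon>2 \<omega>), t) = indicator {w * real n * (herm_norm fc (\<epsilon> \<omega>))\<^sup>2..} ((cmod (dual_fourier fc (\<epsilon> \<omega>) t))\<^sup>2)" for \<omega> t
      unfolding h_def prod.case \<epsilon> herm_norm_square dual_fourier_cis ..
    have tail: "(\<integral>\<^sup>+\<omega>. h ((\<epsilon>1 \<omega>, \<epsilon>2 \<omega>), t) \<partial>M) = ennreal ((1 - w) ^ (n - 1))" for t
    proof -
      have "(\<integral>\<^sup>+\<omega>. h ((\<epsilon>1 \<omega>, \<epsilon>2 \<omega>), t) \<partial>M) = (\<integral>\<^sup>+z. h (z, t) \<partial>distr M (?P \<Otimes>\<^sub>M ?P) (\<lambda>\<omega>. (\<epsilon>1 \<omega>, \<epsilon>2 \<omega>)))"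
        by (rule nn_integral_distr[symmetric]) measurable
      also have "\<dots> = (\<integral>\<^sup>+x. \<integral>\<^sup>+y. h ((x, y), t) \<partial>isotropic_normal (freqs fc) \<sigma>\<^sub>0 \<partial>isotropic_normal (freqs fc) \<sigma>\<^sub>0)"
        unfolding joint[symmetric] by (rule N.nn_integral_fst[symmetric]) measurable
      also have "\<dots> = complex_normal_integral (freqs fc) \<sigma>\<^sub>0 (\<lambda>k. cis (2 * pi * real_of_int k * t))
          (\<lambda>(z, r). indicator {w * real (card (freqs fc)) * r..} ((cmod z)\<^sup>2))"
        unfolding complex_normal_integral_def h_def prod.case card ..
      also have "\<dots> = ennreal ((1 - w) ^ (n - 1))"
        using complex_normal_ratio_tail[OF assms(4) finite_freqs ne _ w] by (simp add: card)
      finally show ?thesis .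
    qed
    \<comment> \<open>If \<open>A\<close> is not measurable, its measure is 0 by convention.\<close>
    have main: "measure M A \<le> (12 * real n - 10) * (1 - w) ^ (n - 1)"
    proof (cases "A \<in> sets M")
      case False
      then have "measure M A = 0" by (rule measure_notin_sets)
      then show ?thesis using w assms(2,3) by simp
    next
      case True
      interpret pair_sigma_finite M lborel ..
      \<comment> \<open>Markov's inequality for the time that |F| spends above the level within the
        window: on A this time is at least D.\<close>
      have "ennreal D * emeasure M A = (\<integral>\<^sup>+\<omega>. ennreal D * indicator A \<omega> \<partial>M)"
        using True by (simp add: nn_integral_cmult_indicator)
      also have "\<dots> \<le> (\<integral>\<^sup>+\<omega>. \<integral>\<^sup>+t. indicator {- D..1 + D} t * h ((\<epsilon>1 \<omega>, \<epsilon>2 \<omega>), t) \<partial>lborel \<partial>M)"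
      proof (rule nn_integral_mono)
        fix \<omega>
        show "ennreal D * indicator A \<omega> \<le> (\<integral>\<^sup>+t. indicator {- D..1 + D} t * h ((\<epsilon>1 \<omega>, \<epsilon>2 \<omega>), t) \<partial>lborel)"
        proof (cases "\<omega> \<in> A")
          case True
          then show ?thesis
            using sup_norm_exceeds_measure[OF assms(2) u(1), of "\<epsilon> \<omega>" n]
            unfolding h_eq D_def w_def by (simp add: A_def)
        qed simp
      qed
      also have "\<dots> = (\<integral>\<^sup>+t. \<integral>\<^sup>+\<omega>. indicator {- D..1 + D} t * h ((\<epsilon>1 \<omega>, \<epsilon>2 \<omega>), t) \<partial>M \<partial>lborel)"
        by (rule Fubini'[symmetric, of "\<lambda>\<omega> t. indicator {- D..1 + D} t * h ((\<epsilon>1 \<omega>, \<epsilon>2 \<omega>), t)"]) measurable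
      also have "\<dots> = (\<integral>\<^sup>+t. ennreal ((1 - w) ^ (n - 1)) * indicator {- D..1 + D} t \<partial>lborel)"
        by (subst nn_integral_cmult) (measurable, simp add: tail mult.commute)
      also have "\<dots> = ennreal ((1 - w) ^ (n - 1)) * ennreal (1 + 2 * D)"
        using D by (subst nn_integral_cmult_indicator) (simp_all only: sets_lborel borel_closed closed_atLeastAtMost, simp add: add.commute)
      finally have "ennreal (D * measure M A) \<le> ennreal ((1 - w) ^ (n - 1) * (1 + 2 * D))"
        using D w by (simp add: emeasure_eq_measure ennreal_mult)
      then have "D * measure M A \<le> (1 - w) ^ (n - 1) * (1 + 2 * D)"
        using D w by (subst (asm) ennreal_le_iff) auto
      then have "measure M A \<le> (1 - w) ^ (n - 1) * ((1 + 2 * D) / D)"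
        using D by (simp add: field_simps)
      \<comment> \<open>1/D + 2 = 24 fc + 2, and 2 fc = n - 1.\<close>
      also have "(1 + 2 * D) / D = 12 * real n - 10"
        using assms(2,3) by (simp add: D_def field_simps)
      finally show ?thesis by (simp add: mult.commute)
    qed
    also have "\<dots> \<le> (12 * real n - 10) * (1 - 93/100 * u\<^sup>2) ^ (n - 1)"
    proof (intro mult_left_mono power_mono)
      show "1 - w \<le> 1 - 93/100 * u\<^sup>2"
        using mult_right_mono[OF cos_pi_12_square, of "u\<^sup>2"] by (simp add: w_def power_mult_distrib)
    qed (use w assms(2,3) in auto)
    finally show ?thesis
      using u assms(2,3) unfolding A_def by (intro tail_comparison) (auto simp: power_le_one)
  qed
  moreover have "?ratio \<omega> \<le> sqrt 2" for \<omega>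
  proof -
    define K where "K = sqrt (real n) * herm_norm fc (\<epsilon> \<omega>)"
    have K: "0 \<le> K" unfolding K_def herm_norm_def by (simp add: L2_set_nonneg)
    obtain t where "cmod (dual_fourier fc (\<epsilon> \<omega>) t) = sup_norm (dual_fourier fc (\<epsilon> \<omega>))"
      using sup_norm_dual_fourier_attained by blast
    then have "sup_norm (dual_fourier fc (\<epsilon> \<omega>)) \<le> K"
      unfolding K_def using cmod_dual_fourier_le[of fc "\<epsilon> \<omega>" t] assms(3) by simp
    then have "sup_norm (dual_fourier fc (\<epsilon> \<omega>)) / K \<le> 1"
      \<comment> \<open>For K = 0 the quotient is 0, so the bound holds for every outcome.\<close>
      using K by (cases "K = 0") (auto simp: divide_le_eq)
    then show ?thesis unfolding K_def using real_sqrt_ge_one[of 2] by linarith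
  qed
  ultimately show ?thesis by simp
qed

end
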